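(* Let $q$ be a power of $2$, let $R=\mathbb{F}_q+u\mathbb{F}_q=\mathbb{F}_q[u]/(u^2)$, and let $\mathcal{C}$ be a linear code of length $n$ over $R$ with generator matrix $G$. Write $GG^T=A_0+uA_1$ with matrices $A_0,A_1$ over $\mathbb{F}_q$. Let $r=\operatorname{rank}_{\mathbb{F}_q}(A_0)$ and let $\rho=\operatorname{rank}_{\mathbb{F}_q}(NA_1N^T)$, where $N$ is a matrix whose rows form a basis of $\operatorname{Rad}(A_0)$. If (i) $\operatorname{Res}(\mathcal{C})$ is not self-orthogonal, (ii) $\mathbf{x}\cdot\mathbf{x}=0$ for every $\mathbf{x}\in\operatorname{Res}(\mathcal{C})$, and (iii) $\rho=0$, then $n_s(\mathcal{C})=n+r+1$. Otherwise (if at least one of (i)--(iii) fails), $n_s(\mathcal{C})=n+r+\rho$.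
   Context: A linear code $\mathcal{C}$ of length $n$ over $R$ is an $R$-submodule of $R^n$. A generator matrix $G$ of $\mathcal{C}$ is a matrix whose rows $\mathbf{c}_1,\dots,\mathbf{c}_{k_1}\in R^n\setminus(uR)^n$ and $\mathbf{c}_{k_1+1},\dots,\mathbf{c}_{k_1+k_2}\in(uR)^n$ are codewords such that every codeword has a unique representation $\sum_{i=1}^{k_1}a_i\mathbf{c}_i+\sum_{j=k_1+1}^{k_1+k_2}b_j\mathbf{c}_j$ with $a_i\in R$, $b_j\in\mathbb{F}_q$. A code (over $R$ or over $\mathbb{F}_q$) is self-orthogonal if $\mathbf{x}\cdot\mathbf{y}=0$ for all its codewords $\mathbf{x},\mathbf{y}$, where $\cdot$ is the standard dot product. $\operatorname{Res}(\mathcal{C})=\mathcal{C}\bmod u$ is the code over $\mathbb{F}_q$ obtained by reducing all codewords modulo $u$. For a symmetric $k\times k$ matrix $A$ over $\mathbb{F}_q$, $\operatorname{Rad}(A)=\{\mathbf{x}\in\mathbb{F}_q^k : \mathbf{x}A=\mathbf{0}\}$. A self-orthogonal embedding of $\mathcal{C}$ is a self-orthogonal code over $R$ generated by the rows of $[G\mid B]$ for some matrix $B$ over $R$ (possibly with zero columns). $n_s(\mathcal{C})$ denotes the smallest length of a self-orthogonal embedding of $\mathcal{C}$. *)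

theory Defs
  imports
    "HOL-Library.Cardinality"
    "Jordan_Normal_Form.DL_Rank"
    "Jordan_Normal_Form.Matrix_Kernel"
begin

section \<open>The ring \<open>F + uF\<close> with \<open>u\<^sup>2 = 0\<close>\<close>

text \<open>\<open>Dual a b\<close> stands for \<open>a + u b\<close>; \<open>res\<close> is reduction modulo \<open>u\<close>.\<close>

datatype 'a dual = Dual (res: 'a) (upart: 'a)

instantiation dual :: (comm_ring_1) comm_ring_1
begin

definition zero_dual :: "'a dual" where "0 = Dual 0 0"
definition one_dual :: "'a dual" where "1 = Dual 1 0"
definition plus_dual :: "'a dual \<Rightarrow> 'a dual \<Rightarrow> 'a dual" where
  "x + y = Dual (res x + res y) (upart x + upart y)"
definition uminus_dual :: "'a dual \<Rightarrow> 'a dual" where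
  "- x = Dual (- res x) (- upart x)"
definition minus_dual :: "'a dual \<Rightarrow> 'a dual \<Rightarrow> 'a dual" where
  "x - y = Dual (res x - res y) (upart x - upart y)"
definition times_dual :: "'a dual \<Rightarrow> 'a dual \<Rightarrow> 'a dual" where
  "x * y = Dual (res x * res y) (res x * upart y + upart x * res y)"

instance
  by standard
    (auto simp: zero_dual_def one_dual_def plus_dual_def uminus_dual_def
      minus_dual_def times_dual_def algebra_simps)

end

definition of_base :: "'a::comm_ring_1 \<Rightarrow> 'a dual" where
  "of_base a = Dual a 0"

definition uu :: "'a::comm_ring_1 dual" where
  "uu = Dual 0 1"

lemma uu_square: "uu * uu = 0"
  by (simp add: uu_def times_dual_def zero_dual_def)

lemma Dual_eq_of_base: "Dual a b = of_base a + uu * of_base b"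
  by (simp add: uu_def of_base_def times_dual_def plus_dual_def)

text \<open>
  The type is the quotient \<open>F[u]/(u\<^sup>2)\<close>: truncating a polynomial is a surjective
  ring homomorphism whose kernel consists of the multiples of \<open>u\<^sup>2\<close>.
\<close>

definition trunc :: "'a::comm_ring_1 poly \<Rightarrow> 'a dual" where
  "trunc p = Dual (coeff p 0) (coeff p 1)"

lemma trunc_hom:
  "trunc (p + q) = trunc p + trunc q"
  "trunc (p * q) = trunc p * trunc q"
  "trunc 1 = 1"
  "trunc [:0, 1:] = uu"
  by (simp_all add: trunc_def plus_dual_def times_dual_def one_dual_def uu_def
      coeff_mult atMost_Suc add.commute)

lemma trunc_surj: "surj trunc"
  by (rule surjI[of _ "\<lambda>x. [:res x, upart x:]"]) (simp add: trunc_def)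

lemma trunc_eq_0_iff:
  "trunc p = 0 \<longleftrightarrow> monom 1 2 dvd (p :: 'a::comm_ring_1 poly)"
  by (auto simp: trunc_def zero_dual_def monom_1_dvd_iff' numeral_2_eq_2 less_Suc_eq)


section \<open>Linear codes and generator matrices\<close>

definition linear_code :: "nat \<Rightarrow> 'a::comm_ring_1 vec set \<Rightarrow> bool" where
  "linear_code n C \<longleftrightarrow> submodule class_ring C (module_vec TYPE('a) n)"

definition self_orthogonal :: "'a::comm_ring_1 vec set \<Rightarrow> bool" where
  "self_orthogonal C \<longleftrightarrow> (\<forall>x\<in>C. \<forall>y\<in>C. x \<bullet> y = 0)"

definition Res :: "'a dual vec set \<Rightarrow> 'a vec set" where
  "Res C = map_vec res ` C"

text \<open>The set \<open>(uR)\<^sup>n\<close>.\<close>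

definition uR_vecs :: "nat \<Rightarrow> 'a::comm_ring_1 dual vec set" where
  "uR_vecs n = {v \<in> carrier_vec n. \<forall>i<n. \<exists>a. v $ i = uu * a}"

text \<open>
  The coefficients \<open>a\<^sub>1, \<dots>, a\<^bsub>k1\<^esub>, b\<^sub>1, \<dots>, b\<^bsub>k2\<^esub>\<close> are collected
  in one vector \<open>w\<close> over \<open>R\<close> whose last \<open>k2\<close> entries lie in \<open>F\<close>; the combination of the
  rows of \<open>G\<close> with coefficients \<open>w\<close> is \<open>G\<^sup>T w\<close>. Rows are indexed from \<open>0\<close>.
\<close>

definition generator_matrix ::
  "nat \<Rightarrow> 'a::comm_ring_1 dual vec set \<Rightarrow> nat \<Rightarrow> nat \<Rightarrow> 'a dual mat \<Rightarrow> bool" where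
  "generator_matrix n C k1 k2 G \<longleftrightarrow>
     G \<in> carrier_mat (k1 + k2) n \<and>
     (\<forall>i<k1 + k2. row G i \<in> C) \<and>
     (\<forall>i<k1. row G i \<in> carrier_vec n - uR_vecs n) \<and>
     (\<forall>i\<in>{k1..<k1 + k2}. row G i \<in> uR_vecs n) \<and>
     (\<forall>c\<in>C. \<exists>!w. w \<in> carrier_vec (k1 + k2) \<and>
        (\<forall>i\<in>{k1..<k1 + k2}. w $ i \<in> range of_base) \<and>
        c = transpose_mat G *\<^sub>v w)"

text \<open>For a square matrix \<open>A\<close>, the condition \<open>x A = 0\<close> on row vectors \<open>x\<close> reads \<open>A\<^sup>T x = 0\<close>.\<close>

definition Rad :: "'a::field mat \<Rightarrow> 'a vec set" where
  "Rad A = mat_kernel (transpose_mat A)"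

text \<open>Distinctness is required because \<open>set (rows N)\<close> forgets repetitions of rows.\<close>

definition rows_form_basis :: "nat \<Rightarrow> 'a::field mat \<Rightarrow> 'a vec set \<Rightarrow> bool" where
  "rows_form_basis k N W \<longleftrightarrow>
     dim_col N = k \<and> distinct (rows N) \<and>
     vectorspace.basis class_ring (module_vec TYPE('a) k \<lparr>carrier := W\<rparr>) (set (rows N))"


section \<open>Self-orthogonal embeddings\<close>

text \<open>The block matrix \<open>[G | B]\<close>.\<close>

definition append_cols :: "'a::zero mat \<Rightarrow> 'a mat \<Rightarrow> 'a mat" where
  "append_cols G B = four_block_mat G B (0\<^sub>m 0 (dim_col G)) (0\<^sub>m 0 (dim_col B))"

definition row_code :: "'a::comm_ring_1 mat \<Rightarrow> 'a vec set" where
  "row_code M =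
     LinearCombinations.module.span class_ring (module_vec TYPE('a) (dim_col M)) (set (rows M))"

text \<open>
  \<open>D\<close> is a self-orthogonal embedding, of length \<open>l\<close>, of the code \<open>C\<close> of length \<open>n\<close>.
  The generator matrix of \<open>C\<close> that is extended is arbitrary.
\<close>

definition self_orthogonal_embedding ::
  "nat \<Rightarrow> 'a::comm_ring_1 dual vec set \<Rightarrow> nat \<Rightarrow> 'a dual vec set \<Rightarrow> bool" where
  "self_orthogonal_embedding n C l D \<longleftrightarrow>
     self_orthogonal D \<and>
     (\<exists>k1 k2 m G B. generator_matrix n C k1 k2 G \<and> B \<in> carrier_mat (k1 + k2) m \<and>
        l = n + m \<and> D = row_code (append_cols G B))"

definition n_s :: "nat \<Rightarrow> 'a::comm_ring_1 dual vec set \<Rightarrow> nat" where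
  "n_s n C = (LEAST l. \<exists>D. self_orthogonal_embedding n C l D)"

end

theory Submission
  imports Defs
begin

text \<open>
  A matrix \<open>B\<close> extends \<open>G\<close> to a self-orthogonal embedding iff \<open>B B\<^sup>T = G G\<^sup>T\<close> (characteristic 2), and
  every other generator matrix \<open>G'\<close> satisfies \<open>G = M G'\<close>, so \<open>B = M B'\<close> turns its extensions into
  extensions of \<open>G\<close>. Over \<open>R\<close> the Gram matrix is congruent to an orthogonal sum of \<open>\<langle>1\<rangle>\<close>'s, hyperbolic
  planes \<open>H\<close>, multiples \<open>u H\<close> and zeros; \<open>r\<close> is the rank of its unit part, \<open>\<rho>\<close> that of its \<open>u\<close>-part.

  For the upper bound, \<open>\<langle>1\<rangle>\<close> is realised in one column, \<open>u H\<close> in two by \<open>(1, 1)\<close> and \<open>(0, u)\<close>, and since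
  \<open>H \<oplus> \<langle>1\<rangle> \<cong> \<langle>1\<rangle> \<oplus> \<langle>1\<rangle> \<oplus> \<langle>1\<rangle>\<close>, each \<open>H\<close> costs two more columns as soon as there is at least one column.
  The exceptional case is the one where the form consists of planes \<open>H\<close> and zeros only.

  For the lower bound, let \<open>\<beta>\<close> be the residues of the rows of \<open>B\<close>. Those in the \<open>u\<close>-part are orthogonal
  to everything; their span and the space of functionals they define have together at least
  \<open>q\<^bsup>\<rho>\<^esup>\<close> pairs of elements, because the \<open>u\<close>-coefficient of \<open>B B\<^sup>T\<close> is invertible there. Adding
  the nondegenerate unit part gives \<open>q\<^bsup>r+\<rho>\<^esup> \<le> q\<^sup>m\<close>. If the unit part is alternating, all its rows are
  orthogonal to the all-ones vector, which then yields one more dimension.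
\<close>

section \<open>Characteristic 2, dual numbers and counting\<close>

text \<open>Translation by 1 permutes the field, so adding 1 to every element leaves the sum of all
  elements unchanged. Hence the cardinality, a power of 2, is zero in the field, and so is
  2.\<close>

lemma char_two_of_card:
  assumes "CARD('f::{field,finite}) = 2 ^ m"
  shows "(1::'f) + 1 = 0"
proof -
  have "(\<Sum>x::'f\<in>UNIV. x) = (\<Sum>x\<in>UNIV. x + 1)"
    by (rule sum.reindex_bij_witness[of _ "\<lambda>x. x + 1" "\<lambda>x. x - 1"]) auto
  then have "of_nat CARD('f) = (0::'f)"
    by (simp add: sum.distrib)
  then have "(2::'f) ^ m = 0"
    by (simp add: assms)
  then have "(2::'f) = 0"
    by simp
  then show ?thesis
    by simp
qed

lemma char_two_add_self:
  fixes x :: "'a::comm_ring_1"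
  assumes "(1::'a) + 1 = 0"
  shows "x + x = 0"
proof -
  have "x + x = x * (1 + 1)"
    by (simp add: algebra_simps)
  then show ?thesis
    by (simp only: assms mult_zero_right)
qed

lemma char_two_minus:
  fixes x :: "'a::comm_ring_1"
  assumes "(1::'a) + 1 = 0"
  shows "- x = x"
  using char_two_add_self[OF assms, of x] by (simp add: eq_neg_iff_add_eq_0)

text \<open>Additivity of the Frobenius map. Over a field it turns the vanishing of a self-product
  into a linear condition: orthogonality to the all-ones vector.\<close>

lemma char_two_square_sum:
  fixes f :: "'b \<Rightarrow> 'a::comm_ring_1"
  assumes "(1::'a) + 1 = 0"
  shows "(\<Sum>i\<in>I. f i * f i) = (\<Sum>i\<in>I. f i) * (\<Sum>i\<in>I. f i)"
proof (induction I rule: infinite_finite_induct)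
  case (insert i I)
  have "f i * sum f I + f i * sum f I = 0"
    using char_two_add_self[OF assms] .
  with insert show ?case
    by (simp add: algebra_simps)
qed auto

text \<open>Here \<open>(y - z) * (y - z)\<close> equals \<open>y * y + z * z\<close>, so squaring
  is injective, hence surjective on a finite field. The roots serve to scale unit diagonal entries
  to 1.\<close>

lemma char_two_square_root:
  fixes x :: "'f::{field,finite}"
  assumes "(1::'f) + 1 = 0"
  obtains y where "y * y = x"
proof -
  have "inj (\<lambda>y::'f. y * y)"
  proof (rule injI)
    fix y z :: 'f
    assume "y * y = z * z"
    moreover have "(y - z) * (y - z) = y * y + z * z - (y * z + y * z)"
      by (simp add: algebra_simps)
    moreover have "y * z + y * z = 0" "z * z + z * z = 0"
      using char_two_add_self[OF assms] by blast+
    ultimately show "y = z"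
      by simp
  qed
  then have "surj (\<lambda>y::'f. y * y)"
    by (simp add: finite_UNIV_inj_surj)
  then show thesis
    using that by (metis surjE)
qed

lemma dual_simps [simp]:
  "res (0::'a::comm_ring_1 dual) = 0" "upart (0::'a dual) = 0"
  "res (1::'a dual) = 1" "upart (1::'a dual) = 0"
  "res (uu::'a dual) = 0" "upart (uu::'a dual) = 1"
  "res (of_base a) = a" "upart (of_base a) = 0"
  "res (x + y) = res x + res y" "upart (x + y) = upart x + upart y"
  "res (- x) = - res x" "upart (- x) = - upart x"
  "res (x - y) = res x - res y" "upart (x - y) = upart x - upart y"
  "res (x * y) = res x * res y" "upart (x * y) = res x * upart y + upart x * res y"
  by (simp_all add: zero_dual_def one_dual_def uu_def of_base_def plus_dual_def
      uminus_dual_def minus_dual_def times_dual_def)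

lemma dual_sum [simp]:
  "res (\<Sum>i\<in>I. f i) = (\<Sum>i\<in>I. res (f i :: 'a::comm_ring_1 dual))"
  "upart (\<Sum>i\<in>I. f i) = (\<Sum>i\<in>I. upart (f i))"
  by (induction I rule: infinite_finite_induct) auto

lemma dual_char_two:
  assumes "(1::'a::comm_ring_1) + 1 = 0"
  shows "(1::'a dual) + 1 = 0"
  by (simp only: one_dual_def plus_dual_def zero_dual_def dual.sel assms add_0_left)

lemma dual_unit:
  fixes x :: "'a::field dual"
  assumes "res x \<noteq> 0"
  obtains y where "x * y = 1"
proof
  show "x * Dual (1 / res x) (- upart x / (res x * res x)) = 1"
    using assms by (intro dual.expand) (simp add: field_simps)
qed

section \<open>Cardinalities in place of dimensions\<close>

lemma card_field_gt_1: "CARD('f::{field,finite}) > 1"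
proof -
  have "card {0, 1 :: 'f} \<le> CARD('f)"
    by (intro card_mono) auto
  then show ?thesis
    by simp
qed

lemma card_carrier_vec:
  "card (carrier_vec n :: 'a::finite vec set) = CARD('a) ^ n"
proof -
  have "bij_betw (vec n) ({..<n} \<rightarrow>\<^sub>E (UNIV::'a set)) (carrier_vec n)"
    by (rule bij_betwI[where g = "\<lambda>v. restrict (($) v) {..<n}"])
      (auto simp: PiE_def extensional_def fun_eq_iff)
  then show ?thesis
    by (auto dest!: bij_betw_same_card simp: card_PiE)
qed

lemma finite_carrier_vec [simp]:
  "finite (carrier_vec n :: 'a::finite vec set)"
  by (rule card_ge_0_finite) (simp add: card_carrier_vec)

text \<open>Makes rank comparisons into comparisons of finite sets. A maximal independent set of
  columns gives a matrix with the same image, and multiplication by that matrix is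
  injective.\<close>

lemma card_mat_image_eq_rank:
  fixes A :: "'f::{field,finite} mat"
  assumes A: "A \<in> carrier_mat n nc"
  shows "card ((*\<^sub>v) A ` carrier_vec nc) = CARD('f) ^ vec_space.rank n A"
proof -
  interpret vec_space "TYPE('f)" n .
  obtain S where "maximal S (\<lambda>T. T \<subseteq> set (cols A) \<and> lin_indpt T)"
    using maximal_exists[of "(\<lambda>T. T \<subseteq> set (cols A) \<and> lin_indpt T)" "card (set (cols A))" "{}"]
    by (meson List.finite_set card_mono empty_iff empty_subsetI finite_lin_indpt2 rev_finite_subset)
  note S = this
  have rank: "rank A = card S"
    by (rule rank_card_indpt[OF A S])
  have indpt: "lin_indpt S" and sub: "S \<subseteq> set (cols A)"
    using S by (auto simp: maximal_def)
  have carr: "set (cols A) \<subseteq> carrier_vec n"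
    using A cols_dim by blast
  have span: "span S = span (set (cols A))"
  proof
    show "span S \<subseteq> span (set (cols A))"
      by (rule span_is_monotone[OF sub])
    \<comment> \<open>By maximality of \<open>S\<close>: a column outside the span could be added
      without losing independence.\<close>
    have "set (cols A) \<subseteq> span S"
    proof
      fix v assume v: "v \<in> set (cols A)"
      show "v \<in> span S"
      proof (rule ccontr)
        assume nv: "v \<notin> span S"
        then have "v \<notin> S"
          using span_mem sub carr by blast
        moreover have "lin_indpt (insert v S)"
          using lin_dep_iff_in_span[of S v] indpt sub carr v nv calculation by auto
        ultimately show False
          using S v sub unfolding maximal_def by (metis insert_subset insertI1 subset_insertI)
      qed
    qed
    then show "span (set (cols A)) \<subseteq> span S"
      using span_is_subset[OF _ span_is_submodule] sub carr by auto
  qed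
  obtain bs where bs: "set bs = S" "distinct bs"
    using sub finite_distinct_list[of S] finite_subset by blast
  define B where "B = mat_of_cols n bs"
  have B: "B \<in> carrier_mat n (card S)"
    using bs distinct_card[of bs] by (auto simp: B_def)
  have cols_B: "cols B = bs"
    unfolding B_def by (rule cols_mat_of_cols) (use bs sub carr in auto)
  have "(*\<^sub>v) B ` carrier_vec (card S) = (*\<^sub>v) A ` carrier_vec nc"
  proof -
    have "(*\<^sub>v) A ` carrier_vec nc = span (set (cols A))"
      using col_space_eq[OF A] A unfolding col_space_def by (auto simp: image_iff)
    moreover have "(*\<^sub>v) B ` carrier_vec (card S) = span S"
      using col_space_eq[OF B] B unfolding col_space_def cols_B bs by (auto simp: image_iff)
    ultimately show ?thesis
      using span by simp
  qed
  moreover have "inj_on ((*\<^sub>v) B) (carrier_vec (card S))"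
  proof (rule inj_onI)
    fix v w assume v: "v \<in> carrier_vec (card S)" and w: "w \<in> carrier_vec (card S)"
      and eq: "B *\<^sub>v v = B *\<^sub>v w"
    have "B *\<^sub>v (v - w) = 0\<^sub>v n"
      using mult_minus_distrib_mat_vec[OF B v w] eq B w by auto
    then have "v - w = 0\<^sub>v (card S)"
      using lin_depI[OF B, of "v - w"] indpt v w bs cols_B by auto
    then have "(v - w) $ i = 0" if "i < card S" for i
      using that by simp
    then show "v = w"
      using v w by (intro eq_vecI) auto
  qed
  ultimately show ?thesis
    by (metis card_image card_carrier_vec rank)
qed

section \<open>Congruence normal form over \<open>R\<close>\<close>

definition congruent_mat :: "nat \<Rightarrow> 'a::comm_ring_1 mat \<Rightarrow> 'a mat \<Rightarrow> bool" where
  "congruent_mat k A A' \<longleftrightarrow>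
     (\<exists>P\<in>carrier_mat k k. \<exists>Q\<in>carrier_mat k k.
        P * Q = 1\<^sub>m k \<and> Q * P = 1\<^sub>m k \<and> A' = P * A * transpose_mat P)"

lemma congruent_mat_refl:
  "A \<in> carrier_mat k k \<Longrightarrow> congruent_mat k A A"
  unfolding congruent_mat_def by (intro bexI[of _ "1\<^sub>m k"]) auto

lemma congruent_mat_trans:
  assumes A: "A \<in> carrier_mat k k"
    and "congruent_mat k A A'" "congruent_mat k A' A''"
  shows "congruent_mat k A A''"
proof -
  obtain P Q where P: "P \<in> carrier_mat k k" and Q: "Q \<in> carrier_mat k k"
    and PQ: "P * Q = 1\<^sub>m k" "Q * P = 1\<^sub>m k" and A': "A' = P * A * transpose_mat P"
    using assms(2) unfolding congruent_mat_def by blast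
  obtain P' Q' where P': "P' \<in> carrier_mat k k" and Q': "Q' \<in> carrier_mat k k"
    and PQ': "P' * Q' = 1\<^sub>m k" "Q' * P' = 1\<^sub>m k" and A'': "A'' = P' * A' * transpose_mat P'"
    using assms(3) unfolding congruent_mat_def by blast
  have "P' * P * (Q * Q') = P' * (P * Q) * Q'" "Q * Q' * (P' * P) = Q * (Q' * P') * P"
    using P Q P' Q' by (simp_all add: assoc_mult_mat[of _ k k _ k _ k])
  moreover have "A'' = P' * P * A * transpose_mat (P' * P)"
    unfolding A'' A' using P P' A
    by (simp add: assoc_mult_mat[of _ k k _ k _ k] transpose_mult[of _ k k _ k])
  ultimately show ?thesis
    unfolding congruent_mat_def using P Q P' Q' PQ PQ'
    by (intro bexI[of _ "P' * P"] bexI[of _ "Q * Q'"]) auto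
qed

section \<open>Elementary congruences and the Gram-matrix invariant\<close>

lemma congruent_mat_scale:
  fixes A :: "'a::comm_ring_1 mat"
  assumes A: "A \<in> carrier_mat k k"
    and inv: "\<And>i. i < k \<Longrightarrow> d i * e i = 1"
  shows "congruent_mat k A (mat k k (\<lambda>(i, j). d i * A $$ (i, j) * d j))"
proof -
  define P where "P = mat k k (\<lambda>(i, j). if j = i then d i else 0)"
  define Q where "Q = mat k k (\<lambda>(i, j). if j = i then e i else 0)"
  have "P * Q = 1\<^sub>m k" "Q * P = 1\<^sub>m k"
    unfolding P_def Q_def using inv
    by (auto intro!: eq_matI simp: scalar_prod_def if_distrib[of "\<lambda>z. z * _"] mult.commute
        cong: if_cong)
  moreover have "mat k k (\<lambda>(i, j). d i * A $$ (i, j) * d j) = P * A * transpose_mat P"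
    using A unfolding P_def
    by (auto intro!: eq_matI simp: scalar_prod_def if_distrib[of "\<lambda>z. z * _"]
        if_distrib[of "\<lambda>z. _ * z"] cong: if_cong)
  ultimately show ?thesis
    unfolding congruent_mat_def
    by (intro bexI[of _ P] bexI[of _ Q]) (auto simp: P_def Q_def)
qed

text \<open>Rows and columns are changed simultaneously by the identity plus a single column
  \<open>x\<close> in position \<open>p\<close>. Because \<open>x p = 0\<close>, the inverse is the
  same matrix for \<open>- x\<close>.\<close>

lemma congruent_mat_add_row:
  fixes A :: "'a::comm_ring_1 mat"
  assumes A: "A \<in> carrier_mat k k" and p: "p < k" and xp: "x p = 0"
  shows "congruent_mat k A
    (mat k k (\<lambda>(i, j). A $$ (i, j) + x i * A $$ (p, j) + x j * A $$ (i, p)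
      + x i * x j * A $$ (p, p)))"
proof -
  define P where "P = (\<lambda>y. mat k k (\<lambda>(i, j).
    (if j = i then 1 else 0) + (if j = p then y i else (0::'a))))"
  have P: "P y \<in> carrier_mat k k" for y
    by (simp add: P_def)
  have PQ: "P y * P (\<lambda>i. - y i) = 1\<^sub>m k" if "y p = 0" for y
    unfolding P_def using that p
    by (auto intro!: eq_matI simp: scalar_prod_def distrib_left distrib_right sum.distrib
        sum_negf if_distrib[of "\<lambda>z. z * _"] if_distrib[of "\<lambda>z. _ * z"] cong: if_cong)
  have "P x * P (\<lambda>i. - x i) = 1\<^sub>m k" "P (\<lambda>i. - x i) * P x = 1\<^sub>m k"
    using PQ[of x] PQ[of "\<lambda>i. - x i"] xp by simp_all
  moreover have "mat k k (\<lambda>(i, j). A $$ (i, j) + x i * A $$ (p, j) + x j * A $$ (i, p)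
      + x i * x j * A $$ (p, p)) = P x * A * transpose_mat (P x)"
    using A p unfolding P_def
    by (auto intro!: eq_matI simp: scalar_prod_def distrib_left distrib_right sum.distrib
        if_distrib[of "\<lambda>z. z * _"] if_distrib[of "\<lambda>z. _ * z"] algebra_simps cong: if_cong)
  ultimately show ?thesis
    unfolding congruent_mat_def using P by blast
qed

text \<open>In characteristic 2 these are the properties of Gram matrices \<open>G G\<^sup>T\<close> over \<open>R\<close> that the
  reduction needs; squares in \<open>R\<close> lie in \<open>F\<close>.\<close>

definition gram_like :: "nat \<Rightarrow> 'a::comm_ring_1 dual mat \<Rightarrow> bool" where
  "gram_like k A \<longleftrightarrow> A \<in> carrier_mat k k \<and>
     (\<forall>i<k. \<forall>j<k. A $$ (i, j) = A $$ (j, i)) \<and> (\<forall>i<k. upart (A $$ (i, i)) = 0)"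

lemma gram_like_scale:
  assumes "(1::'a::comm_ring_1) + 1 = 0" and "gram_like k (A :: 'a dual mat)"
  shows "gram_like k (mat k k (\<lambda>(i, j). d i * A $$ (i, j) * d j))"
proof -
  have "d i * A $$ (i, j) * d j = d j * A $$ (j, i) * d i" if "i < k" "j < k" for i j
  proof -
    have "A $$ (i, j) = A $$ (j, i)"
      using assms(2) that by (auto simp: gram_like_def)
    then show ?thesis
      by (simp only: mult_ac)
  qed
  moreover have "upart (d i * A $$ (i, i) * d i) = 0" if "i < k" for i
    using assms(2) that char_two_add_self[OF assms(1), of "res (d i) * upart (d i) * res (A $$ (i, i))"]
    by (simp add: gram_like_def mult_ac)
  ultimately show ?thesis
    by (simp add: gram_like_def)
qed

text \<open>On the diagonal the two mixed terms agree by symmetry and cancel, and the factor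
  \<open>x i * x i\<close> is a square, so it has no u-part.\<close>

lemma gram_like_add_row:
  assumes "(1::'a::comm_ring_1) + 1 = 0" and "gram_like k (A :: 'a dual mat)" and "p < k"
  shows "gram_like k (mat k k (\<lambda>(i, j). A $$ (i, j) + x i * A $$ (p, j) + x j * A $$ (i, p)
      + x i * x j * A $$ (p, p)))"
proof -
  have sym: "A $$ (i, j) = A $$ (j, i)" if "i < k" "j < k" for i j
    using assms(2) that by (auto simp: gram_like_def)
  have "A $$ (i, j) + x i * A $$ (p, j) + x j * A $$ (i, p) + x i * x j * A $$ (p, p) =
    A $$ (j, i) + x j * A $$ (p, i) + x i * A $$ (j, p) + x j * x i * A $$ (p, p)"
    if "i < k" "j < k" for i j
    using sym[OF that] sym[OF that(1) assms(3)] sym[OF that(2) assms(3)]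
    by (simp only: add_ac mult_ac)
  moreover have "upart (A $$ (i, i) + x i * A $$ (p, i) + x i * A $$ (i, p)
      + x i * x i * A $$ (p, p)) = 0" if i: "i < k" for i
  proof -
    have "upart (x i * A $$ (p, i)) + upart (x i * A $$ (i, p)) = 0"
      unfolding sym[OF assms(3) i] by (rule char_two_add_self[OF assms(1)])
    moreover have "upart (A $$ (i, i)) = 0" "upart (A $$ (p, p)) = 0"
      using assms(2,3) i by (auto simp: gram_like_def)
    moreover have "upart (x i * x i) = 0"
      using char_two_add_self[OF assms(1), of "res (x i) * upart (x i)"]
      by (simp add: mult.commute)
    ultimately show ?thesis
      by (simp only: dual_simps(10,16) mult_zero_right mult_zero_left add_0_left add_0_right
          mult.assoc[symmetric])
  qed
  ultimately show ?thesis
    by (simp add: gram_like_def del: dual_simps)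
qed

text \<open>The value of \<open>c\<close> on an orbit of the involution \<open>\<pi>\<close> names the form on it: a fixed point is
  \<open>\<langle>1\<rangle>\<close> or \<open>\<langle>0\<rangle>\<close>, and a pair is the hyperbolic plane or its multiple by \<open>u\<close>.\<close>

definition pairing :: "nat set \<Rightarrow> (nat \<Rightarrow> nat) \<Rightarrow> (nat \<Rightarrow> 'a::comm_ring_1 dual) \<Rightarrow> bool" where
  "pairing K \<pi> c \<longleftrightarrow> (\<forall>i\<in>K. \<pi> i \<in> K \<and> \<pi> (\<pi> i) = i \<and> c (\<pi> i) = c i \<and>
     (c i = 1 \<or> c i = uu \<and> \<pi> i \<noteq> i \<or> c i = 0 \<and> \<pi> i = i))"

definition monomial_mat :: "nat \<Rightarrow> (nat \<Rightarrow> nat) \<Rightarrow> (nat \<Rightarrow> 'a::zero) \<Rightarrow> 'a mat" where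
  "monomial_mat k \<pi> c = mat k k (\<lambda>(i, j). if j = \<pi> i then c i else 0)"

text \<open>\<open>D\<close> collects the indices already split off. Their rows are prescribed
  across all \<open>k\<close> columns, so with the symmetry in \<open>gram_like\<close> they are
  orthogonal to the other indices, and reduction can continue outside \<open>D\<close>.\<close>

definition reduced_on ::
  "nat \<Rightarrow> nat set \<Rightarrow> (nat \<Rightarrow> nat) \<Rightarrow> (nat \<Rightarrow> 'a::comm_ring_1 dual) \<Rightarrow> 'a dual mat \<Rightarrow> bool" where
  "reduced_on k D \<pi> c A \<longleftrightarrow> gram_like k A \<and> D \<subseteq> {..<k} \<and> pairing D \<pi> c \<and>
     (\<forall>i\<in>D. \<forall>j<k. A $$ (i, j) = (if j = \<pi> i then c i else 0))"

lemma reduced_on_zero: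
  assumes "reduced_on k D \<pi> c A" "i \<in> D" "j < k" "j \<notin> D"
  shows "A $$ (i, j) = 0" "A $$ (j, i) = 0"
proof -
  show "A $$ (i, j) = 0"
    using assms by (auto simp: reduced_on_def pairing_def)
  moreover have "A $$ (j, i) = A $$ (i, j)"
    using assms by (auto simp: reduced_on_def gram_like_def)
  ultimately show "A $$ (j, i) = 0"
    by simp
qed

lemma reduced_on_scale:
  assumes two: "(1::'a::comm_ring_1) + 1 = 0" and red: "reduced_on k D \<pi> c (A :: 'a dual mat)"
    and p: "p < k" "p \<notin> D" and z: "z * z' = 1"
  obtains A' where "congruent_mat k A A'" "reduced_on k D \<pi> c A'"
    "\<And>i j. i < k \<Longrightarrow> j < k \<Longrightarrow>
      A' $$ (i, j) = (if i = p then z else 1) * A $$ (i, j) * (if j = p then z else 1)"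
proof
  let ?d = "\<lambda>i. if i = p then z else 1"
  let ?A = "mat k k (\<lambda>(i, j). ?d i * A $$ (i, j) * ?d j)"
  show "congruent_mat k A ?A"
    by (rule congruent_mat_scale[where e = "\<lambda>i. if i = p then z' else 1"])
      (use red z in \<open>auto simp: reduced_on_def gram_like_def\<close>)
  have "gram_like k ?A"
    using gram_like_scale[OF two, of k A ?d] red by (simp add: reduced_on_def)
  then show "reduced_on k D \<pi> c ?A"
    using red p by (auto simp: reduced_on_def pairing_def subset_iff)
qed auto

text \<open>Neither the added rows nor the added columns reach the finished part: \<open>x\<close>
  vanishes on \<open>D\<close>, and the rows in \<open>D\<close> are zero in column
  \<open>p\<close>.\<close>

lemma reduced_on_add_row:
  assumes two: "(1::'a::comm_ring_1) + 1 = 0" and red: "reduced_on k D \<pi> c (A :: 'a dual mat)"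
    and p: "p < k" "p \<notin> D" and x: "x p = 0" "\<And>i. i \<in> D \<Longrightarrow> x i = 0"
  obtains A' where "congruent_mat k A A'" "reduced_on k D \<pi> c A'"
    "\<And>i j. i < k \<Longrightarrow> j < k \<Longrightarrow>
      A' $$ (i, j) = A $$ (i, j) + x i * A $$ (p, j) + x j * A $$ (i, p) + x i * x j * A $$ (p, p)"
proof
  let ?A = "mat k k (\<lambda>(i, j). A $$ (i, j) + x i * A $$ (p, j) + x j * A $$ (i, p)
    + x i * x j * A $$ (p, p))"
  show "congruent_mat k A ?A"
    by (rule congruent_mat_add_row) (use red p x in \<open>auto simp: reduced_on_def gram_like_def\<close>)
  have "gram_like k ?A"
    using gram_like_add_row[OF two _ p(1)] red by (simp add: reduced_on_def)
  then show "reduced_on k D \<pi> c ?A"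
    using red p x reduced_on_zero[OF red _ p] by (auto simp: reduced_on_def subset_iff)
qed auto

text \<open>A diagonal entry has no u-part, so a nonzero one is a unit of F and has a square root
  there. Dividing by the root makes the pivot 1, which splits off a summand
  \<open>\<langle>1\<rangle>\<close>.\<close>

lemma reduce_singleton:
  assumes two: "(1::'f::{field,finite}) + 1 = 0"
    and red: "reduced_on k D \<pi> c (A :: 'f dual mat)"
    and p: "p < k" "p \<notin> D" and nz: "A $$ (p, p) \<noteq> 0"
  obtains A' where "congruent_mat k A A'" "reduced_on k (insert p D) (\<pi>(p := p)) (c(p := 1)) A'"
proof -
  have gram: "gram_like k A"
    using red by (simp add: reduced_on_def)
  then have upart: "upart (A $$ (p, p)) = 0"
    using p by (simp add: gram_like_def)
  then have res: "res (A $$ (p, p)) \<noteq> 0"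
    using nz by (metis dual.expand dual_simps(1,2))
  obtain b where b: "b * b = res (A $$ (p, p))"
    by (rule char_two_square_root[OF two])
  then have b0: "b \<noteq> 0"
    using res by auto
  obtain A1 where A1: "congruent_mat k A A1" "reduced_on k D \<pi> c A1"
    "\<And>i j. i < k \<Longrightarrow> j < k \<Longrightarrow> A1 $$ (i, j) =
      (if i = p then of_base (1 / b) else 1) * A $$ (i, j) * (if j = p then of_base (1 / b) else 1)"
    by (rule reduced_on_scale[OF two red p, of "of_base (1 / b)" "of_base b"])
      (use b0 in \<open>auto intro: dual.expand\<close>)
  have A1p: "A1 $$ (p, p) = 1"
    unfolding A1(3)[OF p(1) p(1)] using upart b b0
    by (intro dual.expand) (simp flip: b)
  \<comment> \<open>With pivot 1, subtracting \<open>A1 $$ (i, p)\<close> times row \<open>p\<close>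
    from each unfinished row \<open>i\<close> clears column \<open>p\<close>.\<close>
  obtain A2 where A2: "congruent_mat k A1 A2" "reduced_on k D \<pi> c A2"
    "\<And>i j. i < k \<Longrightarrow> j < k \<Longrightarrow> A2 $$ (i, j) = A1 $$ (i, j)
      + (if i \<in> insert p D then 0 else - A1 $$ (i, p)) * A1 $$ (p, j)
      + (if j \<in> insert p D then 0 else - A1 $$ (j, p)) * A1 $$ (i, p)
      + (if i \<in> insert p D then 0 else - A1 $$ (i, p)) *
        (if j \<in> insert p D then 0 else - A1 $$ (j, p)) * A1 $$ (p, p)"
    by (rule reduced_on_add_row[OF two A1(2) p,
        of "\<lambda>i. if i \<in> insert p D then 0 else - A1 $$ (i, p)"]) auto
  have A1zero: "A1 $$ (j, p) = 0" "A1 $$ (p, j) = 0" if "j \<in> D" for j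
    using reduced_on_zero[OF A1(2) that p] by auto
  have A1sym: "A1 $$ (p, j) = A1 $$ (j, p)" if "j < k" for j
    using A1(2) that p by (auto simp: reduced_on_def gram_like_def)
  have row: "A2 $$ (p, j) = (if j = p then 1 else 0)" if "j < k" for j
    using that p A1p A1zero A1sym[OF that] by (auto simp: A2(3))
  have "A2 $$ (i, p) = 0" if "i \<in> D" for i
    using reduced_on_zero[OF A2(2) that p] by simp
  then have "reduced_on k (insert p D) (\<pi>(p := p)) (c(p := 1)) A2"
    using A2(2) p row unfolding reduced_on_def pairing_def by (auto split: if_splits)
  moreover have "congruent_mat k A A2"
    using congruent_mat_trans[OF _ A1(1) A2(1)] gram by (simp add: gram_like_def)
  ultimately show thesis
    using that by blast
qed

text \<open>Since u is not invertible, elimination with the pivot \<open>e\<close> works only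
  because \<open>e\<close> divides the whole unfinished block. The zero diagonal entries at
  \<open>p\<close> and \<open>q\<close> keep the two clearing operations from disturbing each
  other.\<close>

lemma reduce_pair:
  assumes two: "(1::'f::{field,finite}) + 1 = 0"
    and red: "reduced_on k D \<pi> c (A :: 'f dual mat)"
    and p: "p < k" "p \<notin> D" and q: "q < k" "q \<notin> D" and pq: "p \<noteq> q"
    and e: "e = 1 \<or> e = uu" and z: "A $$ (p, q) = e * z" "z * z' = 1"
    and dvd: "\<And>i j. i < k \<Longrightarrow> i \<notin> D \<Longrightarrow> j < k \<Longrightarrow> j \<notin> D \<Longrightarrow> e dvd A $$ (i, j)"
    and diag: "A $$ (p, p) = 0" "A $$ (q, q) = 0"
  obtains A' where "congruent_mat k A A'"
    "reduced_on k (insert p (insert q D)) (\<pi>(p := q, q := p)) (c(p := e, q := e)) A'"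
proof -
  have gram: "gram_like k A"
    using red by (simp add: reduced_on_def)
  obtain A1 where A1: "congruent_mat k A A1" "reduced_on k D \<pi> c A1"
    "\<And>i j. i < k \<Longrightarrow> j < k \<Longrightarrow> A1 $$ (i, j) =
      (if i = p then z' else 1) * A $$ (i, j) * (if j = p then z' else 1)"
    by (rule reduced_on_scale[OF two red p, of z' z]) (use z in \<open>auto simp: mult.commute\<close>)
  have "z' * (e * z) = e * (z * z')"
    by (simp add: mult_ac)
  then have A1pq: "A1 $$ (p, q) = e" "A1 $$ (p, p) = 0" "A1 $$ (q, q) = 0"
    using p q pq z diag by (auto simp: A1(3))
  have "\<exists>w. A1 $$ (i, j) = e * w" if ij: "i < k" "i \<notin> D" "j < k" "j \<notin> D" for i j
  proof -
    have "e dvd A1 $$ (i, j)"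
      unfolding A1(3)[OF ij(1,3)] by (intro dvd_mult2 dvd_mult dvd ij)
    then show ?thesis
      by (rule dvdE) blast
  qed
  then obtain w where w: "\<And>i j. i < k \<Longrightarrow> i \<notin> D \<Longrightarrow> j < k \<Longrightarrow> j \<notin> D \<Longrightarrow> A1 $$ (i, j) = e * w i j"
    by metis
  \<comment> \<open>Row \<open>p\<close> has its entry \<open>e\<close> in column \<open>q\<close>,
    so it clears column \<open>q\<close>; row \<open>q\<close> clears column \<open>p\<close>. Hence
    \<open>x\<close> takes the quotients from column \<open>q\<close> and \<open>y\<close> those
    from column \<open>p\<close>.\<close>
  define x where "x = (\<lambda>i. if i \<in> insert p (insert q D) then 0 else - w i q)"
  define y where "y = (\<lambda>i. if i \<in> insert p (insert q D) then 0 else - w i p)"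
  obtain A2 where A2: "congruent_mat k A1 A2" "reduced_on k D \<pi> c A2"
    "\<And>i j. i < k \<Longrightarrow> j < k \<Longrightarrow> A2 $$ (i, j) = A1 $$ (i, j)
      + x i * A1 $$ (p, j) + x j * A1 $$ (i, p) + x i * x j * A1 $$ (p, p)"
    by (rule reduced_on_add_row[OF two A1(2) p, of x]) (auto simp: x_def)
  have sym: "B $$ (i, j) = B $$ (j, i)" if "reduced_on k D \<pi> c B" "i < k" "j < k" for B i j
    using that by (auto simp: reduced_on_def gram_like_def)
  have A1qp: "A1 $$ (q, p) = e"
    using sym[OF A1(2) q(1) p(1)] A1pq by simp
  have A2q: "A2 $$ (i, q) = (if i = p then e else 0)" if i: "i < k" for i
  proof (cases "i \<in> insert p (insert q D)")
    case True
    then consider "i = p" | "i = q" | "i \<in> D"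
      by blast
    then show ?thesis
      using reduced_on_zero(1)[OF A2(2) _ q, of i] A1pq p q pq
      by cases (auto simp: A2(3) x_def)
  next
    case False
    then have "A2 $$ (i, q) = A1 $$ (i, q) - w i q * e"
      using i p q pq A1pq by (auto simp: A2(3) x_def)
    then show ?thesis
      using w[of i q] False i q by (auto simp: mult.commute)
  qed
  have A2p: "A2 $$ (i, p) = A1 $$ (i, p)" if "i < k" for i
    using that p A1pq by (auto simp: A2(3) x_def)
  obtain A3 where A3: "congruent_mat k A2 A3" "reduced_on k D \<pi> c A3"
    "\<And>i j. i < k \<Longrightarrow> j < k \<Longrightarrow> A3 $$ (i, j) = A2 $$ (i, j)
      + y i * A2 $$ (q, j) + y j * A2 $$ (i, q) + y i * y j * A2 $$ (q, q)"
    by (rule reduced_on_add_row[OF two A2(2) q, of y]) (auto simp: y_def)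
  have A3q: "A3 $$ (i, q) = (if i = p then e else 0)" if i: "i < k" for i
    using i q pq p A2q by (auto simp: A3(3) y_def)
  have A3p: "A3 $$ (i, p) = (if i = q then e else 0)" if i: "i < k" for i
  proof (cases "i \<in> insert p (insert q D)")
    case True
    then consider "i = p" | "i = q" | "i \<in> D"
      by blast
    then show ?thesis
      using reduced_on_zero(1)[OF A3(2) _ p, of i] A1pq A1qp A2p A2q p q pq
      by cases (auto simp: A3(3) y_def)
  next
    case False
    then have "A3 $$ (i, p) = A1 $$ (i, p) - w i p * e"
      using i p q pq A2p A2q A1qp by (auto simp: A3(3) y_def)
    then show ?thesis
      using w[of i p] False i p by (auto simp: mult.commute)
  qed
  have rows: "A3 $$ (q, j) = (if j = p then e else 0)" "A3 $$ (p, j) = (if j = q then e else 0)"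
    if "j < k" for j
    using sym[OF A3(2) q(1) that] sym[OF A3(2) p(1) that] A3p[OF that] A3q[OF that] by simp_all
  have zero: "A3 $$ (i, p) = 0" "A3 $$ (i, q) = 0" if "i \<in> D" for i
    using reduced_on_zero[OF A3(2) that p] reduced_on_zero[OF A3(2) that q] by simp_all
  have "reduced_on k (insert p (insert q D)) (\<pi>(p := q, q := p)) (c(p := e, q := e)) A3"
    using A3(2) p q pq e rows zero unfolding reduced_on_def pairing_def
    by (auto split: if_splits)
  moreover have "congruent_mat k A A3"
    using congruent_mat_trans[OF _ A1(1) congruent_mat_trans[OF _ A2(1) A3(1)]] gram A1(2)
    by (simp add: reduced_on_def gram_like_def)
  ultimately show thesis
    using that by blast
qed

text \<open>Pivots are chosen in the order: nonzero diagonal entries, off-diagonal units, nonzero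
  multiples of u. Exhausting one kind supplies the diagonal and divisibility hypotheses for
  splitting off the next.\<close>

lemma reduced_on_extend:
  assumes two: "(1::'f::{field,finite}) + 1 = 0"
    and red: "reduced_on k D \<pi> c (A :: 'f dual mat)"
  shows "\<exists>A' \<pi>' c'. congruent_mat k A A' \<and> reduced_on k {..<k} \<pi>' c' A'"
  using red
proof (induction "card ({..<k} - D)" arbitrary: D \<pi> c A rule: less_induct)
  case less
  have D: "D \<subseteq> {..<k}" and A: "A \<in> carrier_mat k k"
    using less.prems by (auto simp: reduced_on_def gram_like_def)
  have step: ?case
    if "congruent_mat k A A'" "reduced_on k D' \<pi>' c' A'" "D \<subset> D'" for A' D' \<pi>' c'
  proof -
    have "{..<k} - D' \<subset> {..<k} - D"
      using that(2,3) by (auto simp: reduced_on_def)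
    then have "card ({..<k} - D') < card ({..<k} - D)"
      by (simp add: psubset_card_mono)
    from less.hyps[OF this that(2)] show ?thesis
      using congruent_mat_trans[OF A that(1)] by blast
  qed
  show ?case
  proof (cases "\<exists>p<k. p \<notin> D \<and> A $$ (p, p) \<noteq> 0")
    case True
    then obtain p where p: "p < k" "p \<notin> D" "A $$ (p, p) \<noteq> 0"
      by blast
    show ?thesis
      by (rule reduce_singleton[OF two less.prems p], rule step) (use p in auto)
  next
    case diag: False
    show ?thesis
    proof (cases "\<exists>p q. p < k \<and> p \<notin> D \<and> q < k \<and> q \<notin> D \<and> res (A $$ (p, q)) \<noteq> 0")
      case True
      then obtain p q where pq: "p < k" "p \<notin> D" "q < k" "q \<notin> D" "res (A $$ (p, q)) \<noteq> 0"
        by blast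
      then have "p \<noteq> q"
        using diag by auto
      moreover obtain z' where "A $$ (p, q) * z' = 1"
        using dual_unit[OF pq(5)] .
      moreover have "A $$ (p, p) = 0" "A $$ (q, q) = 0"
        using pq diag by auto
      ultimately obtain A' where "congruent_mat k A A'"
        "reduced_on k (insert p (insert q D)) (\<pi>(p := q, q := p)) (c(p := 1, q := 1)) A'"
        using reduce_pair[OF two less.prems pq(1-4), of 1 "A $$ (p, q)" z'] by auto
      then show ?thesis
        by (rule step) (use pq in auto)
    next
      case nonunit: False
      have uR: "A $$ (i, j) = uu * of_base (upart (A $$ (i, j)))"
        if "i < k" "i \<notin> D" "j < k" "j \<notin> D" for i j
        using nonunit that by (intro dual.expand) auto
      show ?thesis
      proof (cases "\<exists>p q. p < k \<and> p \<notin> D \<and> q < k \<and> q \<notin> D \<and> A $$ (p, q) \<noteq> 0")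
        case True
        then obtain p q where pq: "p < k" "p \<notin> D" "q < k" "q \<notin> D" "A $$ (p, q) \<noteq> 0"
          by blast
        then have "p \<noteq> q"
          using diag by auto
        define z where "z = upart (A $$ (p, q))"
        have "z \<noteq> 0"
          using pq nonunit unfolding z_def by (metis dual.expand dual_simps(1,2))
        then have "of_base z * of_base (1 / z) = 1"
          by (intro dual.expand) simp
        moreover have "A $$ (p, q) = uu * of_base z"
          unfolding z_def by (rule uR[OF pq(1-4)])
        moreover have "A $$ (p, p) = 0" "A $$ (q, q) = 0"
          using pq diag by auto
        moreover have "uu dvd A $$ (i, j)" if "i < k" "i \<notin> D" "j < k" "j \<notin> D" for i j
          by (rule dvdI[OF uR[OF that]])
        ultimately obtain A' where "congruent_mat k A A'"
          "reduced_on k (insert p (insert q D)) (\<pi>(p := q, q := p)) (c(p := uu, q := uu)) A'"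
          using reduce_pair[OF two less.prems pq(1-4), of uu "of_base z" "of_base (1 / z)"]
            \<open>p \<noteq> q\<close> by blast
        then show ?thesis
          by (rule step) (use pq in auto)
      next
        case zero: False
        \<comment> \<open>Only zeros are left outside \<open>D\<close>, so every remaining index
          becomes a fixed point with value 0.\<close>
        define \<pi>' where "\<pi>' = (\<lambda>i. if i \<in> D then \<pi> i else i)"
        define c' where "c' = (\<lambda>i. if i \<in> D then c i else 0)"
        have "A $$ (i, j) = 0" if "i < k" "i \<notin> D" "j < k" for i j
          using that zero reduced_on_zero(2)[OF less.prems _ that(1,2)] by (cases "j \<in> D") auto
        then have "reduced_on k {..<k} \<pi>' c' A"
          using less.prems
          unfolding reduced_on_def pairing_def \<pi>'_def c'_def by auto
        then show ?thesis
          using congruent_mat_refl[OF A] by blast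
      qed
    qed
  qed
qed

theorem gram_like_normal_form:
  assumes "(1::'f::{field,finite}) + 1 = 0" and "gram_like k (A :: 'f dual mat)"
  obtains P Q \<pi> c where "P \<in> carrier_mat k k" "Q \<in> carrier_mat k k"
    "P * Q = 1\<^sub>m k" "Q * P = 1\<^sub>m k"
    "pairing {..<k} \<pi> c" "P * A * transpose_mat P = monomial_mat k \<pi> c"
proof -
  have "reduced_on k {} id (\<lambda>_. 0) A"
    using assms(2) by (simp add: reduced_on_def pairing_def)
  then obtain A' \<pi> c where "congruent_mat k A A'" and red: "reduced_on k {..<k} \<pi> c A'"
    using reduced_on_extend[OF assms(1)] by blast
  moreover have "A' = monomial_mat k \<pi> c"
    using red unfolding reduced_on_def gram_like_def monomial_mat_def
    by (intro eq_matI) auto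
  ultimately show thesis
    using that unfolding congruent_mat_def reduced_on_def by metis
qed

section \<open>The least number of columns realising a normal form\<close>

text \<open>Vectors are functions whose values from \<open>m\<close> on are ignored, so columns can
  be appended without changing carriers.\<close>

definition dot :: "nat \<Rightarrow> (nat \<Rightarrow> 'a) \<Rightarrow> (nat \<Rightarrow> 'a) \<Rightarrow> 'a::comm_ring_1" where
  "dot m v w = (\<Sum>t<m. v t * w t)"

lemma dot_commute: "dot m v w = dot m w v"
  by (simp add: dot_def mult.commute)

lemma dot_linear:
  "dot m (\<lambda>t. v t + w t) z = dot m v z + dot m w z"
  "dot m (\<lambda>t. v t - w t) z = dot m v z - dot m w z"
  "dot m (\<lambda>t. \<Sum>i\<in>I. a i * f i t) z = (\<Sum>i\<in>I. a i * dot m (f i) z)"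
  by (simp_all add: dot_def sum.distrib sum_subtractf algebra_simps sum_distrib_left
      sum.swap[of _ _ I])

lemma dot_restrict [simp]: "dot m (restrict v {..<m}) w = dot m v w"
  by (simp add: dot_def)

text \<open>\<open>b i\<close> is row \<open>i\<close> of a matrix with \<open>m\<close> columns.
  Arbitrary index sets \<open>K\<close> let orthogonal summands be added or removed orbit by
  orbit.\<close>

definition realizes ::
  "nat \<Rightarrow> nat set \<Rightarrow> (nat \<Rightarrow> nat) \<Rightarrow> (nat \<Rightarrow> 'a::comm_ring_1) \<Rightarrow> (nat \<Rightarrow> nat \<Rightarrow> 'a) \<Rightarrow> bool" where
  "realizes m K \<pi> c b \<longleftrightarrow> (\<forall>i\<in>K. \<forall>j\<in>K. dot m (b i) (b j) = (if j = \<pi> i then c i else 0))"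

section \<open>Upper bound: assembling orthogonal summands\<close>

lemma pairing_Diff:
  assumes "pairing K \<pi> c" "pairing L \<pi> c" "L \<subseteq> K"
  shows "pairing (K - L) \<pi> c"
  using assms unfolding pairing_def by (metis DiffD1 DiffD2 DiffI)

lemma pairing_orbit:
  assumes "pairing K \<pi> c" "i \<in> K"
  shows "pairing {i, \<pi> i} \<pi> c"
  using assms by (auto simp: pairing_def)

text \<open>The rows in \<open>L\<close> live in \<open>l\<close> fresh columns, where the old rows
  are 0. Closure of \<open>K\<close> and \<open>L\<close> under \<pi> makes all prescribed mixed
  products 0.\<close>

lemma realizes_Un:
  assumes b: "realizes m K \<pi> c b" and pair: "pairing K \<pi> c" "pairing L \<pi> c" "K \<inter> L = {}"
    and v: "\<And>i j. i \<in> L \<Longrightarrow> j \<in> L \<Longrightarrow>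
      (\<Sum>t\<in>{m..<m + l}. v i t * v j t) = (if j = \<pi> i then c i else 0)"
  shows "\<exists>b. realizes (m + l) (K \<union> L) \<pi> c b"
proof -
  define b' where "b' = (\<lambda>i t. if i \<in> L then (if t < m then 0 else v i t)
    else (if t < m then b i t else 0))"
  have "{..<m + l} = {..<m} \<union> {m..<m + l}"
    by auto
  then have split: "dot (m + l) (b' i) (b' j) =
      (\<Sum>t<m. b' i t * b' j t) + (\<Sum>t\<in>{m..<m + l}. b' i t * b' j t)" for i j
    unfolding dot_def by (simp add: sum.union_disjoint ivl_disj_int)
  have "realizes (m + l) (K \<union> L) \<pi> c b'"
    unfolding realizes_def
  proof (intro ballI)
    fix i j assume ij: "i \<in> K \<union> L" "j \<in> K \<union> L"
    consider "i \<in> K" "j \<in> K" | "i \<in> L" "j \<in> L" | "i \<in> K" "j \<in> L" | "i \<in> L" "j \<in> K"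
      using ij by blast
    then show "dot (m + l) (b' i) (b' j) = (if j = \<pi> i then c i else 0)"
    proof cases
      case 1
      then have "i \<notin> L" "j \<notin> L"
        using pair by auto
      then show ?thesis
        using b 1 unfolding split by (simp add: b'_def realizes_def dot_def)
    next
      case 2
      then show ?thesis
        using v[OF 2] unfolding split by (simp add: b'_def)
    next
      case 3
      then have "i \<notin> L" "j \<noteq> \<pi> i"
        using pair by (auto simp: pairing_def)
      then show ?thesis
        using 3 unfolding split by (simp add: b'_def)
    next
      case 4
      then have "j \<notin> L" "j \<noteq> \<pi> i"
        using pair by (auto simp: pairing_def)
      then show ?thesis
        using 4 unfolding split by (simp add: b'_def)
    qed
  qed
  then show ?thesis
    by blast
qed

text \<open>Each orbit takes as many columns as it has indices with nonzero value: one for a fixed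
  point with value 1, two for a pair with value u, none for 0.\<close>

lemma realizes_without_unit_pairs:
  fixes c :: "nat \<Rightarrow> 'f::field dual"
  assumes two: "(1::'f) + 1 = 0"
    and "finite K" "pairing K \<pi> c" "\<And>i. i \<in> K \<Longrightarrow> c i = 1 \<Longrightarrow> \<pi> i = i"
  shows "\<exists>b. realizes (card {i \<in> K. c i \<noteq> 0}) K \<pi> c b"
  using assms(2-4)
proof (induction K rule: finite_psubset_induct)
  case (psubset K)
  have two': "(1::'f dual) + 1 = 0"
    by (rule dual_char_two[OF two])
  show ?case
  proof (cases "K = {}")
    case False
    then obtain i where i: "i \<in> K"
      by blast
    define L where "L = {i, \<pi> i}"
    have LK: "L \<subseteq> K"
      using psubset.prems(1) i by (auto simp: L_def pairing_def)
    have L: "pairing L \<pi> c"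
      unfolding L_def by (rule pairing_orbit[OF psubset.prems(1) i])
    have KL: "pairing (K - L) \<pi> c"
      by (rule pairing_Diff[OF psubset.prems(1) L LK])
    obtain b where b: "realizes (card {i \<in> K - L. c i \<noteq> 0}) (K - L) \<pi> c b"
      using psubset.IH[of "K - L"] KL psubset.prems i by (auto simp: L_def)
    define m where "m = card {i \<in> K - L. c i \<noteq> 0}"
    have "{i \<in> K. c i \<noteq> 0} = {i \<in> K - L. c i \<noteq> 0} \<union> {i \<in> L. c i \<noteq> 0}"
      using LK by auto
    then have card: "card {i \<in> K. c i \<noteq> 0} = m + card {i \<in> L. c i \<noteq> 0}"
      unfolding m_def using psubset.hyps finite_subset[OF LK]
      by (simp add: card_Un_disjoint disjoint_iff)
    have pi: "\<pi> i \<in> K" "\<pi> (\<pi> i) = i" "c (\<pi> i) = c i"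
      using psubset.prems(1) i by (auto simp: pairing_def)
    have ex: "\<exists>b. realizes (m + l) (K - L \<union> L) \<pi> c b"
      if "\<And>i j. i \<in> L \<Longrightarrow> j \<in> L \<Longrightarrow>
        (\<Sum>t\<in>{m..<m + l}. v i t * v j t) = (if j = \<pi> i then c i else 0)" for l v
      by (rule realizes_Un[OF b[folded m_def] KL L _ that]) auto
    consider "c i = 1" "\<pi> i = i" | "c i = uu" "\<pi> i \<noteq> i" | "c i = 0" "\<pi> i = i"
      using psubset.prems i by (auto simp: pairing_def)
    then have "\<exists>b. realizes (m + card {i \<in> L. c i \<noteq> 0}) (K - L \<union> L) \<pi> c b"
    proof cases
      case 1
      then have "{i \<in> L. c i \<noteq> 0} = {i}"
        by (auto simp: L_def)
      then show ?thesis
        using 1 by (intro ex[where v = "\<lambda>_ _. 1"]) (auto simp: L_def)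
    next
      case 2
      have uu: "(uu::'f dual) \<noteq> 0"
        by (metis dual_simps(2,6) zero_neq_one)
      have "{i \<in> L. c i \<noteq> 0} = {i, \<pi> i}"
        using 2 pi uu by (auto simp: L_def)
      then have "card {i \<in> L. c i \<noteq> 0} = 2"
        using 2 by simp
      moreover have "{m..<m + 2} = {m, Suc m}"
        by auto
      \<comment> \<open>The rows are (1, 1) and (0, u): the self-products 1 + 1 and u^2 vanish, and
        the mixed product is u.\<close>
      ultimately show ?thesis
        using 2 pi two' uu_square
        by (intro ex[where v = "\<lambda>j t. if j = i then 1 else if t = m then 0 else uu"])
          (auto simp: L_def simp del: one_add_one)
    next
      case 3
      then have "{i \<in> L. c i \<noteq> 0} = {}"
        by (auto simp: L_def)
      then show ?thesis
        using 3 by (intro ex[where v = "\<lambda>_ _. 0"]) (auto simp: L_def)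
    qed
    then show ?thesis
      unfolding card using LK by (simp add: Un_absorb2)
  qed (auto simp: realizes_def)
qed

text \<open>Replacing the basis vector \<open>e\<^sub>0\<close> by \<open>e\<^sub>0 + e\<^sub>m + e\<^bsub>m+1\<^esub>\<close> preserves inner products in
  characteristic 2, and the new vectors are orthogonal to the hyperbolic plane spanned by
  \<open>e\<^sub>0 + e\<^sub>m\<close> and \<open>e\<^sub>m + e\<^bsub>m+1\<^esub>\<close>.\<close>

lemma realizes_add_unit_pair:
  fixes b :: "nat \<Rightarrow> nat \<Rightarrow> 'a::comm_ring_1"
  assumes two: "(1::'a) + 1 = 0" and b: "realizes m K \<pi> c b" and m: "m > 0"
    and K: "\<And>i. i \<in> K \<Longrightarrow> \<pi> i \<in> K"
    and pq: "p \<notin> K" "q \<notin> K" "p \<noteq> q" "\<pi> p = q" "\<pi> q = p" "c p = 1" "c q = 1"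
  shows "\<exists>b. realizes (m + 2) (K \<union> {p, q}) \<pi> c b"
proof -
  define b' where "b' = (\<lambda>i t. if i = p then (if t = 0 \<or> t = m then 1 else 0)
    else if i = q then (if t = m \<or> t = Suc m then 1 else 0)
    else if t < m then b i t else b i 0)"
  have split: "dot (m + 2) (b' i) (b' j) = (\<Sum>t<m. b' i t * b' j t)
      + b' i m * b' j m + b' i (Suc m) * b' j (Suc m)" for i j
    by (simp add: dot_def)
  have self: "x + x = 0" for x :: 'a
    by (rule char_two_add_self[OF two])
  have ij: "dot (m + 2) (b' i) (b' j) = (if j = \<pi> i then c i else 0)" if "i \<in> K" "j \<in> K" for i j
  proof -
    have "i \<noteq> p" "i \<noteq> q" "j \<noteq> p" "j \<noteq> q"
      using that pq by auto
    \<comment> \<open>Both new columns repeat entry 0 of the old rows, so their contributions are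
      equal and cancel.\<close>
    then have "dot (m + 2) (b' i) (b' j) = dot m (b i) (b j) + (b i 0 * b j 0 + b i 0 * b j 0)"
      unfolding split by (simp add: b'_def dot_def)
    then show ?thesis
      using b that by (simp only: self add_0_right realizes_def)
  qed
  have "(\<Sum>t<m. (if t = 0 \<or> t = m then 1 else 0) * x t) = (x 0 :: 'a)" for x
    using m by (subst sum.cong[OF refl, of _ _ "\<lambda>t. if t = 0 then x t else 0"]) auto
  note pt = this
  have pi: "dot (m + 2) (b' p) (b' i) = 0" if "i \<in> K" for i
  proof -
    have "i \<noteq> p" "i \<noteq> q"
      using that pq by auto
    then show ?thesis
      unfolding split using pq(3) m pt[of "b i"] self by (simp add: b'_def)
  qed
  have qi: "dot (m + 2) (b' q) (b' i) = 0" if "i \<in> K" for i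
  proof -
    have "i \<noteq> p" "i \<noteq> q"
      using that pq by auto
    then show ?thesis
      unfolding split using pq(3) m self by (simp add: b'_def)
  qed
  have pp: "dot (m + 2) (b' p) (b' p) = 0"
    unfolding split using m pt[of "\<lambda>t. if t = 0 \<or> t = m then 1 else 0"] two
    by (simp add: b'_def del: one_add_one)
  have qq: "dot (m + 2) (b' q) (b' q) = 0"
    unfolding split using m pq(3) two by (simp add: b'_def del: one_add_one)
  have pq': "dot (m + 2) (b' p) (b' q) = 1"
    unfolding split using m pq(3) by (simp add: b'_def)
  have "realizes (m + 2) (K \<union> {p, q}) \<pi> c b'"
    unfolding realizes_def
  proof (intro ballI)
    fix i j assume *: "i \<in> K \<union> {p, q}" "j \<in> K \<union> {p, q}"
    consider "i \<in> K" "j \<in> K" | "i = p" "j \<in> K" | "i = q" "j \<in> K" | "i \<in> K" "j = p" | "i \<in> K" "j = q"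
      | "i = p" "j = p" | "i = p" "j = q" | "i = q" "j = p" | "i = q" "j = q"
      using * by blast
    then show "dot (m + 2) (b' i) (b' j) = (if j = \<pi> i then c i else 0)"
      using ij pi qi pp qq pq' pq K dot_commute[of "m + 2" "b' i" "b' j"] by cases auto
  qed
  then show ?thesis
    by blast
qed

text \<open>Hyperbolic planes are attached one at a time. The number of columns only grows, so the
  positivity that each attachment requires persists.\<close>

lemma realizes_add_unit_pairs:
  fixes b :: "nat \<Rightarrow> nat \<Rightarrow> 'f::field dual"
  assumes two: "(1::'f) + 1 = 0" and m: "m > 0"
    and b: "realizes m K \<pi> c b" and K: "pairing K \<pi> c"
    and "finite H" "pairing H \<pi> c" "H \<inter> K = {}" "\<And>i. i \<in> H \<Longrightarrow> c i = 1 \<and> \<pi> i \<noteq> i"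
  shows "\<exists>b. realizes (m + card H) (K \<union> H) \<pi> c b"
  using assms(5-8)
proof (induction H rule: finite_psubset_induct)
  case (psubset H)
  show ?case
  proof (cases "H = {}")
    case True
    then show ?thesis
      using b by auto
  next
    case False
    then obtain p where p: "p \<in> H"
      by blast
    define q where "q = \<pi> p"
    have q: "q \<in> H" "\<pi> q = p" "p \<noteq> q" "c p = 1" "c q = 1"
      using psubset.prems(1) psubset.prems(3)[OF p] p by (auto simp: q_def pairing_def)
    have pairing: "pairing (H - {p, q}) \<pi> c"
      unfolding q_def
      by (rule pairing_Diff[OF psubset.prems(1) pairing_orbit[OF psubset.prems(1) p]])
        (use p q in \<open>auto simp: q_def\<close>)
    obtain b' where b': "realizes (m + card (H - {p, q})) (K \<union> (H - {p, q})) \<pi> c b'"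
      using psubset.IH[of "H - {p, q}"] psubset.prems pairing p by auto
    have "\<exists>b. realizes (m + card (H - {p, q}) + 2) (K \<union> (H - {p, q}) \<union> {p, q}) \<pi> c b"
      by (rule realizes_add_unit_pair[OF dual_char_two[OF two] b'])
        (use K pairing m p q psubset.prems in \<open>auto simp: pairing_def q_def\<close>)
    moreover have "K \<union> (H - {p, q}) \<union> {p, q} = K \<union> H"
      using p q by auto
    moreover have "card H = card (H - {p, q}) + card {p, q}"
      using p q psubset.hyps by (metis card_Diff_subset card_mono finite.emptyI finite.insertI
          empty_subsetI insert_subset le_add_diff_inverse2)
    ultimately show ?thesis
      using q by (simp add: add.assoc)
  qed
qed

lemma pairing_subset:
  assumes "pairing K \<pi> c" "\<And>i. i \<in> K \<Longrightarrow> P (\<pi> i) = P i"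
  shows "pairing {i \<in> K. P i} \<pi> c"
  using assms by (auto simp: pairing_def)

theorem realizes_exists:
  fixes c :: "nat \<Rightarrow> 'f::field dual"
  assumes two: "(1::'f) + 1 = 0" and K: "finite K" "pairing K \<pi> c"
    and r: "r = card {i \<in> K. c i = 1}" and \<rho>: "\<rho> = card {i \<in> K. c i = uu}"
  shows "\<exists>b. realizes (if r > 0 \<and> (\<forall>i\<in>K. c i = 1 \<longrightarrow> \<pi> i \<noteq> i) \<and> \<rho> = 0
    then r + 1 else r + \<rho>) K \<pi> c b"
proof -
  define H where "H = {i \<in> K. c i = 1 \<and> \<pi> i \<noteq> i}"
  define L where "L = {i \<in> K. \<not> (c i = 1 \<and> \<pi> i \<noteq> i)}"
  have pi: "c (\<pi> i) = c i" "\<pi> (\<pi> i) = i" "c i = 1 \<or> c i = uu \<or> c i = 0" if "i \<in> K" for i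
    using K(2) that by (auto simp: pairing_def)
  have orbit: "(c (\<pi> i) = 1 \<and> \<pi> (\<pi> i) \<noteq> \<pi> i) = (c i = 1 \<and> \<pi> i \<noteq> i)" if "i \<in> K" for i
    using pi[OF that] by auto
  have H: "pairing H \<pi> c" and L: "pairing L \<pi> c"
    unfolding H_def L_def using orbit by (intro pairing_subset[OF K(2)]; simp)+
  have LH: "L \<union> H = K" "H \<inter> L = {}"
    by (auto simp: H_def L_def)
  have fin: "finite L" "finite H"
    using K by (auto simp: H_def L_def)
  obtain b where b: "realizes (card {i \<in> L. c i \<noteq> 0}) L \<pi> c b"
    using realizes_without_unit_pairs[OF two fin(1) L] by (auto simp: L_def)
  have distinct: "(1::'f dual) \<noteq> 0" "(uu::'f dual) \<noteq> 0" "(uu::'f dual) \<noteq> 1"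
    by (metis dual_simps zero_neq_one)+
  have "{i \<in> L. c i \<noteq> 0} \<union> H = {i \<in> K. c i = 1} \<union> {i \<in> K. c i = uu}"
    using pi(3) distinct by (auto simp: H_def L_def)
  then have "card ({i \<in> L. c i \<noteq> 0} \<union> H) = card ({i \<in> K. c i = 1} \<union> {i \<in> K. c i = uu})"
    by simp
  moreover have "card ({i \<in> L. c i \<noteq> 0} \<union> H) = card {i \<in> L. c i \<noteq> 0} + card H"
    using fin LH by (intro card_Un_disjoint) auto
  moreover have "card ({i \<in> K. c i = 1} \<union> {i \<in> K. c i = uu}) = r + \<rho>"
    unfolding r \<rho> using K distinct by (intro card_Un_disjoint) auto
  ultimately have card: "card {i \<in> L. c i \<noteq> 0} + card H = r + \<rho>"
    by simp
  \<comment> \<open>If \<open>L\<close> occupies a column, every hyperbolic plane can be attached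
    for two more; if there are no planes, \<open>L\<close> alone is enough. Both give r +
    \<rho>.\<close>
  show ?thesis
  proof (cases "card {i \<in> L. c i \<noteq> 0} > 0 \<or> H = {}")
    case True
    have "\<exists>b. realizes (r + \<rho>) K \<pi> c b"
    proof (cases "H = {}")
      case True
      then show ?thesis
        using b card LH by auto
    next
      case False
      with True have "card {i \<in> L. c i \<noteq> 0} > 0"
        by simp
      then have "\<exists>b. realizes (card {i \<in> L. c i \<noteq> 0} + card H) (L \<union> H) \<pi> c b"
        by (rule realizes_add_unit_pairs[OF two _ b L fin(2) H LH(2)]) (simp add: H_def)
      then show ?thesis
        by (simp only: card LH(1))
    qed
    moreover have "\<not> (r > 0 \<and> (\<forall>i\<in>K. c i = 1 \<longrightarrow> \<pi> i \<noteq> i) \<and> \<rho> = 0)"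
    proof
      assume *: "r > 0 \<and> (\<forall>i\<in>K. c i = 1 \<longrightarrow> \<pi> i \<noteq> i) \<and> \<rho> = 0"
      then have "{i \<in> K. c i = uu} = {}"
        using K unfolding \<rho> by simp
      then have "{i \<in> L. c i \<noteq> 0} = {}"
        using * pi(3) by (auto simp: L_def)
      then have "H = {}"
        using True by (metis card.empty less_irrefl)
      then have "{i \<in> K. c i = 1} = {}"
        using * by (auto simp: H_def)
      then show False
        using * r by (metis card.empty less_irrefl)
    qed
    ultimately show ?thesis
      by (simp only: if_False)
  next
    case False
    then have empty: "{i \<in> L. c i \<noteq> 0} = {}" and "H \<noteq> {}"
      using fin by auto
    have "{i \<in> K. c i = uu} = {}"
      using empty distinct unfolding L_def by auto
    then have "\<rho> = 0"
      by (simp only: \<rho> card.empty)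
    \<comment> \<open>Now \<open>L\<close> carries only zeros and would take no column. One zero
      column is supplied as a starting point for the planes; this is the extra 1.\<close>
    have b1: "realizes 1 L \<pi> c (\<lambda>_ _. 0)"
      using empty by (auto simp: realizes_def dot_def)
    have "\<exists>b. realizes (1 + card H) (L \<union> H) \<pi> c b"
      by (rule realizes_add_unit_pairs[OF two _ b1 L fin(2) H LH(2)]) (auto simp: H_def)
    moreover have "r = card H"
      using card empty \<open>\<rho> = 0\<close> by (metis add_0 add_0_right card.empty)
    moreover have "r > 0"
      using \<open>r = card H\<close> \<open>H \<noteq> {}\<close> fin by (simp add: card_gt_0_iff)
    moreover have "\<forall>i\<in>K. c i = 1 \<longrightarrow> \<pi> i \<noteq> i"
      using empty distinct by (auto simp: L_def)
    ultimately show ?thesis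
      using LH \<open>\<rho> = 0\<close> by simp
  qed
qed

section \<open>Lower bound: counting orthogonal vectors\<close>

text \<open>\<open>J\<close>, representatives of \<open>I\<close>, and the span of the \<open>\<beta> i\<close> with \<open>i \<in> D\<close> are independent of each
  other: pairing a sum with \<open>\<beta> (\<pi> i)\<close> recovers the coefficient of \<open>\<beta> i\<close>, and pairing it with the
  \<open>\<beta> j\<close> for \<open>j \<in> E\<close> recovers the element of \<open>I\<close>.\<close>

lemma card_orthogonal_le:
  fixes \<beta> :: "nat \<Rightarrow> nat \<Rightarrow> 'f::{field,finite}"
  assumes fin: "finite D" and pi: "\<And>i. i \<in> D \<Longrightarrow> \<pi> i \<in> D \<and> \<pi> (\<pi> i) = i"
    and D: "\<And>i j. i \<in> D \<Longrightarrow> j \<in> D \<Longrightarrow> dot m (\<beta> i) (\<beta> j) = (if j = \<pi> i then 1 else 0)"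
    and E: "\<And>i j. i \<in> D \<Longrightarrow> j \<in> E \<Longrightarrow> dot m (\<beta> i) (\<beta> j) = 0"
    and J: "J \<subseteq> ({..<m} \<rightarrow>\<^sub>E UNIV)" "\<And>v i. v \<in> J \<Longrightarrow> i \<in> D \<union> E \<Longrightarrow> dot m v (\<beta> i) = 0"
  shows "card J * card (range (\<lambda>v. \<lambda>j\<in>E. dot m v (\<beta> j))) * CARD('f) ^ card D \<le> CARD('f) ^ m"
proof -
  let ?I = "range (\<lambda>v. \<lambda>j\<in>E. dot m v (\<beta> j))"
  have "\<exists>s. (\<forall>j\<in>E. dot m s (\<beta> j) = w j) \<and> (\<forall>i\<in>D. dot m s (\<beta> i) = 0)" if "w \<in> ?I" for w
  proof -
    obtain v where v: "w = (\<lambda>j\<in>E. dot m v (\<beta> j))"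
      using \<open>w \<in> ?I\<close> by blast
    \<comment> \<open>Subtracting the projection to the span of the rows in \<open>D\<close> makes
      \<open>v\<close> orthogonal to them; products with rows in \<open>E\<close> are unchanged,
      since \<open>D\<close> and \<open>E\<close> are orthogonal. The dual of
      \<open>\<beta> l\<close> is \<open>\<beta> (\<pi> l)\<close>.\<close>
    define s where "s = (\<lambda>t. v t - (\<Sum>l\<in>D. dot m v (\<beta> (\<pi> l)) * \<beta> l t))"
    have "dot m s (\<beta> j) = w j" if "j \<in> E" for j
      using that unfolding s_def dot_linear v by (simp add: E)
    moreover have "dot m s (\<beta> i) = 0" if i: "i \<in> D" for i
    proof -
      have "(\<Sum>l\<in>D. dot m v (\<beta> (\<pi> l)) * dot m (\<beta> l) (\<beta> i)) =
          (\<Sum>l\<in>D. if l = \<pi> i then dot m v (\<beta> i) else 0)"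
        using i pi by (intro sum.cong) (auto simp: D)
      then show ?thesis
        using i pi fin unfolding s_def dot_linear by simp
    qed
    ultimately show ?thesis
      by blast
  qed
  then obtain s where s: "\<And>w j. w \<in> ?I \<Longrightarrow> j \<in> E \<Longrightarrow> dot m (s w) (\<beta> j) = w j"
    "\<And>w i. w \<in> ?I \<Longrightarrow> i \<in> D \<Longrightarrow> dot m (s w) (\<beta> i) = 0"
    by metis
  define f where "f = (\<lambda>(v, w, x). \<lambda>t\<in>{..<m}. (v t + s w t) + (\<Sum>i\<in>D. x i * \<beta> i t))"
  have dot_f: "dot m (f (v, w, x)) z = dot m v z + dot m (s w) z + (\<Sum>i\<in>D. x i * dot m (\<beta> i) z)"
    for v w x z
    unfolding f_def by (simp add: dot_linear)
  have "inj_on f (J \<times> ?I \<times> (D \<rightarrow>\<^sub>E UNIV))"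
  proof (rule inj_onI)
    fix X X' assume X: "X \<in> J \<times> ?I \<times> (D \<rightarrow>\<^sub>E UNIV)" "X' \<in> J \<times> ?I \<times> (D \<rightarrow>\<^sub>E UNIV)"
      and "f X = f X'"
    obtain v y x v' y' x' where XX': "X = (v, y, x)" "X' = (v', y', x')"
      by (cases X, cases X') auto
    have v: "v \<in> J" "v' \<in> J" and y: "y \<in> ?I" "y' \<in> ?I"
      and x: "x \<in> D \<rightarrow>\<^sub>E UNIV" "x' \<in> D \<rightarrow>\<^sub>E UNIV"
      using X by (auto simp: XX' simp del: image_iff)
    have eq: "f (v, y, x) = f (v', y', x')"
      using \<open>f X = f X'\<close> by (simp add: XX')
    have xi: "x i = x' i" if i: "i \<in> D" for i
    proof -
      have pii: "\<pi> i \<in> D"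
        using i pi by blast
      have coeff: "(\<Sum>l\<in>D. z l * dot m (\<beta> l) (\<beta> (\<pi> i))) = z i" for z
      proof -
        have "(\<Sum>l\<in>D. z l * dot m (\<beta> l) (\<beta> (\<pi> i))) = (\<Sum>l\<in>D. if l = i then z l else 0)"
        proof (rule sum.cong[OF refl])
          fix l assume "l \<in> D"
          moreover from this have "\<pi> i = \<pi> l \<longleftrightarrow> l = i"
            using i pi by metis
          ultimately show "z l * dot m (\<beta> l) (\<beta> (\<pi> i)) = (if l = i then z l else 0)"
            using pii by (simp add: D)
        qed
        then show ?thesis
          using i fin by simp
      qed
      show ?thesis
        using arg_cong[OF eq, of "\<lambda>z. dot m z (\<beta> (\<pi> i))"] v y pii
        by (simp add: dot_f coeff J s)
    qed
    have xx': "x = x'"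
      by (rule PiE_ext[OF x xi])
    have "y j = y' j" if "j \<in> E" for j
      using arg_cong[OF eq, of "\<lambda>z. dot m z (\<beta> j)"] v y that
      by (simp add: dot_f J s E)
    then have yy': "y = y'"
      using y by (auto simp: fun_eq_iff)
    have "v t = v' t" if "t < m" for t
      using fun_cong[OF eq, of t] that by (simp add: f_def xx' yy')
    then have "v = v'"
      using v J(1) by (intro PiE_ext[of v "{..<m}" "\<lambda>_. UNIV" v']) auto
    with xx' yy' show "X = X'"
      by (simp add: XX')
  qed
  moreover have "f ` (J \<times> ?I \<times> (D \<rightarrow>\<^sub>E UNIV)) \<subseteq> ({..<m} \<rightarrow>\<^sub>E UNIV)"
    by (auto simp: f_def split: if_splits)
  moreover have "finite ({..<m} \<rightarrow>\<^sub>E (UNIV :: 'f set))"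
    by (intro finite_PiE) auto
  ultimately have "card (J \<times> ?I \<times> (D \<rightarrow>\<^sub>E (UNIV :: 'f set))) \<le> card ({..<m} \<rightarrow>\<^sub>E (UNIV :: 'f set))"
    by (rule card_inj_on_le)
  then show ?thesis
    using fin by (simp add: card_cartesian_product card_PiE mult.assoc)
qed

theorem realizes_lower_bound:
  fixes b :: "nat \<Rightarrow> nat \<Rightarrow> 'f::{field,finite} dual"
  assumes two: "(1::'f) + 1 = 0" and K: "finite K" "pairing K \<pi> c" and b: "realizes m K \<pi> c b"
    and r: "r = card {i \<in> K. c i = 1}" and \<rho>: "\<rho> = card {i \<in> K. c i = uu}"
  shows "(if r > 0 \<and> (\<forall>i\<in>K. c i = 1 \<longrightarrow> \<pi> i \<noteq> i) \<and> \<rho> = 0 then r + 1 else r + \<rho>) \<le> m"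
proof -
  define D where "D = {i \<in> K. c i = 1}"
  define E where "E = {i \<in> K. c i = uu}"
  define \<beta> where "\<beta> = (\<lambda>i t. res (b i t))"
  define \<gamma> where "\<gamma> = (\<lambda>i t. upart (b i t))"
  have DK: "finite D" "finite E" "D \<subseteq> K" "E \<subseteq> K"
    using K by (auto simp: D_def E_def)
  have pi: "\<pi> i \<in> K" "\<pi> (\<pi> i) = i" "c (\<pi> i) = c i" if "i \<in> K" for i
    using K(2) that by (auto simp: pairing_def)
  \<comment> \<open>Residues and u-coefficients of the products over R give two separate systems
    over F.\<close>
  have dot0: "dot m (\<beta> i) (\<beta> j) = (if j = \<pi> i then res (c i) else 0)"
    and dot1: "dot m (\<beta> i) (\<gamma> j) + dot m (\<gamma> i) (\<beta> j) = (if j = \<pi> i then upart (c i) else 0)"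
    if "i \<in> K" "j \<in> K" for i j
  proof -
    have "dot m (b i) (b j) = (if j = \<pi> i then c i else 0)"
      using b that by (simp add: realizes_def)
    from arg_cong[OF this, of res] arg_cong[OF this, of upart]
    show "dot m (\<beta> i) (\<beta> j) = (if j = \<pi> i then res (c i) else 0)"
      "dot m (\<beta> i) (\<gamma> j) + dot m (\<gamma> i) (\<beta> j) = (if j = \<pi> i then upart (c i) else 0)"
      by (auto simp: dot_def \<beta>_def \<gamma>_def sum.distrib split: if_splits)
  qed
  have q: "CARD('f) > 1"
    by (rule card_field_gt_1)
  have piD: "\<And>i. i \<in> D \<Longrightarrow> \<pi> i \<in> D \<and> \<pi> (\<pi> i) = i"
    using pi by (auto simp: D_def)
  have DD: "\<And>i j. i \<in> D \<Longrightarrow> j \<in> D \<Longrightarrow> dot m (\<beta> i) (\<beta> j) = (if j = \<pi> i then 1 else 0)"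
    using dot0 DK by (auto simp: D_def)
  have "r + \<rho> \<le> m"
  proof -
    have zero: "dot m (\<beta> i) (\<beta> j) = 0" if "i \<in> D \<union> E" "j \<in> E" for i j
    proof -
      have "(uu::'f dual) \<noteq> 1"
        by (metis dual_simps(3,5) zero_neq_one)
      then show ?thesis
        using dot0[of i j] that pi[of i] by (auto simp: D_def E_def)
    qed
    define comb where "comb = (\<lambda>y. \<lambda>t\<in>{..<m}. \<Sum>l\<in>E. y l * \<beta> l t)"
    have dot_comb: "dot m (comb y) z = (\<Sum>l\<in>E. y l * dot m (\<beta> l) z)" for y z
      by (simp add: comb_def dot_linear)
    \<comment> \<open>\<open>J\<close> is the span of the residues in the u-part, and
      \<open>I\<close> the set of functionals on \<open>E\<close> that vectors induce. The residues
      may be linearly dependent, so only the product of the two sizes is bounded below.\<close>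
    define J where "J = range comb"
    define I where "I = range (\<lambda>v. \<lambda>j\<in>E. dot m v (\<beta> j))"
    have J: "J \<subseteq> {..<m} \<rightarrow>\<^sub>E UNIV"
      by (auto simp: J_def comb_def split: if_splits)
    have le: "card J * card I * CARD('f) ^ card D \<le> CARD('f) ^ m"
      unfolding I_def
    proof (rule card_orthogonal_le[OF DK(1) piD DD _ J])
      show "dot m (\<beta> i) (\<beta> j) = 0" if "i \<in> D" "j \<in> E" for i j
        using zero that by blast
      show "dot m v (\<beta> i) = 0" if "v \<in> J" "i \<in> D \<union> E" for v i
      proof -
        have "dot m (\<beta> j) (\<beta> i) = 0" if "j \<in> E" for j
          using zero[OF \<open>i \<in> D \<union> E\<close> that] by (simp add: dot_commute)
        then show ?thesis
          using \<open>v \<in> J\<close> by (auto simp: J_def dot_comb)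
      qed
    qed
    have finJ: "finite J"
      using J by (rule finite_subset) (intro finite_PiE; simp)
    have finI: "finite I"
      by (rule finite_subset[of _ "E \<rightarrow>\<^sub>E UNIV"]) (use DK in \<open>auto simp: I_def intro!: finite_PiE\<close>)
    \<comment> \<open>Every function on \<open>E\<close> comes from a pair in \<open>I\<close> and
      \<open>J\<close>, because \<open>dot1\<close> couples \<beta> and \<gamma> nondegenerately. So
      the product of the two sizes is at least q^\<rho>.\<close>
    have "(E \<rightarrow>\<^sub>E UNIV) \<subseteq> (\<lambda>(w, v). \<lambda>l\<in>E. w l + dot m v (\<gamma> l)) ` (I \<times> J)"
    proof
      fix y :: "nat \<Rightarrow> 'f" assume y: "y \<in> E \<rightarrow>\<^sub>E UNIV"
      \<comment> \<open>\<open>dot1\<close> couples index \<open>i\<close> with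
        \<open>\<pi> i\<close>, hence the coefficient \<open>y (\<pi> i)\<close>: evaluation at
        \<open>l\<close> then returns \<open>y l\<close>.\<close>
      define a where "a = (\<lambda>t. \<Sum>i\<in>E. y (\<pi> i) * \<gamma> i t)"
      have "dot m a (\<beta> l) + dot m (comb (\<lambda>i. y (\<pi> i))) (\<gamma> l) = y l" if l: "l \<in> E" for l
      proof -
        have pl: "\<pi> l \<in> E" "\<pi> (\<pi> l) = l"
          using l pi by (auto simp: E_def)
        have "dot m a (\<beta> l) + dot m (comb (\<lambda>i. y (\<pi> i))) (\<gamma> l) =
            (\<Sum>i\<in>E. y (\<pi> i) * (dot m (\<beta> i) (\<gamma> l) + dot m (\<gamma> i) (\<beta> l)))"
          by (simp add: a_def dot_linear dot_comb sum.distrib distrib_left add.commute)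
        also have "\<dots> = (\<Sum>i\<in>E. if i = \<pi> l then y l else 0)"
        proof (rule sum.cong[OF refl])
          fix i assume i: "i \<in> E"
          then have "upart (c i) = 1" "i \<in> K" "l \<in> K"
            using l by (auto simp: E_def)
          moreover have "l = \<pi> i \<longleftrightarrow> i = \<pi> l"
            using pl pi[OF \<open>i \<in> K\<close>] by auto
          ultimately show "y (\<pi> i) * (dot m (\<beta> i) (\<gamma> l) + dot m (\<gamma> i) (\<beta> l)) =
              (if i = \<pi> l then y l else 0)"
            using dot1[of i l] by auto
        qed
        also have "\<dots> = y l"
          using pl DK by simp
        finally show ?thesis .
      qed
      then have "y = (\<lambda>l\<in>E. (\<lambda>j\<in>E. dot m a (\<beta> j)) l + dot m (comb (\<lambda>i. y (\<pi> i))) (\<gamma> l))"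
        using y by (auto simp: fun_eq_iff PiE_def extensional_def)
      then show "y \<in> (\<lambda>(w, v). \<lambda>l\<in>E. w l + dot m v (\<gamma> l)) ` (I \<times> J)"
        by (intro image_eqI[where x = "(\<lambda>j\<in>E. dot m a (\<beta> j), comb (\<lambda>i. y (\<pi> i)))"])
          (auto simp: I_def J_def)
    qed
    then have "card (E \<rightarrow>\<^sub>E (UNIV::'f set)) \<le> card (I \<times> J)"
      by (rule surj_card_le[rotated]) (use finI finJ in simp)
    then have "CARD('f) ^ card E \<le> card J * card I"
      using DK by (simp add: card_PiE card_cartesian_product mult.commute)
    then have "CARD('f) ^ card E * CARD('f) ^ card D \<le> CARD('f) ^ m"
      using le by (meson le_trans mult_le_mono1)
    then have "card E + card D \<le> m"
      using q by (simp flip: power_add)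
    then show ?thesis
      by (simp add: r \<rho> D_def E_def add.commute)
  qed
  moreover have "r + 1 \<le> m" if r0: "r > 0" and alt: "\<forall>i\<in>K. c i = 1 \<longrightarrow> \<pi> i \<noteq> i"
  proof -
    have "m > 0"
      using \<open>r + \<rho> \<le> m\<close> r0 by simp
    \<comment> \<open>The multiples of the all-ones vector, which are q distinct vectors because m >
      0. With the empty set in place of \<open>E\<close>, the middle factor of the count is
      1.\<close>
    define J where "J = range (\<lambda>\<alpha>::'f. \<lambda>t\<in>{..<m}. \<alpha>)"
    have "card J * card (range (\<lambda>v. \<lambda>j\<in>{}. dot m v (\<beta> j))) * CARD('f) ^ card D \<le> CARD('f) ^ m"
    proof (rule card_orthogonal_le[OF DK(1) piD DD])
      show "J \<subseteq> {..<m} \<rightarrow>\<^sub>E UNIV"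
        by (auto simp: J_def split: if_splits)
      fix v i assume v: "v \<in> J" and i: "i \<in> D \<union> {}"
      \<comment> \<open>The unit part is alternating, and a zero self-product means a zero
        coordinate sum, that is, orthogonality to the constants.\<close>
      have "dot m (\<beta> i) (\<beta> i) = 0"
        using DD[of i i] alt i by (auto simp: D_def)
      then have "(\<Sum>t<m. \<beta> i t) = 0"
        by (simp add: dot_def char_two_square_sum[OF two])
      then show "dot m v (\<beta> i) = 0"
        using v by (auto simp: J_def dot_def simp flip: sum_distrib_left)
    qed auto
    moreover have "inj (\<lambda>\<alpha>::'f. \<lambda>t\<in>{..<m}. \<alpha>)"
      using \<open>m > 0\<close> by (auto simp: inj_def fun_eq_iff restrict_def)
    then have "card J = CARD('f)"
      unfolding J_def by (rule card_image)
    moreover have "range (\<lambda>v. \<lambda>j\<in>{}. dot m v (\<beta> j)) = {\<lambda>_. undefined}"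
      by (auto simp: restrict_def)
    ultimately have "CARD('f) ^ (card D + 1) \<le> CARD('f) ^ m"
      by simp
    then have "card D + 1 \<le> m"
      by (rule power_le_imp_le_exp[OF q])
    then show ?thesis
      by (simp add: r D_def)
  qed
  ultimately show ?thesis
    by auto
qed

section \<open>Embeddings and Gram matrices\<close>

lemma smult_rows_in_code:
  assumes C: "linear_code n C" and G: "G \<in> carrier_mat k n"
    and rows: "\<And>i. i < k \<Longrightarrow> row G i \<in> C" and w: "w \<in> carrier_vec k"
  shows "transpose_mat G *\<^sub>v w \<in> C"
proof -
  interpret submodule class_ring C "module_vec TYPE('a) n"
    using C by (simp add: linear_code_def)
  have "vec n (\<lambda>t. \<Sum>i<j. G $$ (i, t) * w $ i) \<in> C" if "j \<le> k" for j
    using that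
  proof (induction j)
    case 0
    then show ?case
      using zero_closed by (simp add: module_vec_simps zero_vec_def)
  next
    case (Suc j)
    have "vec n (\<lambda>t. \<Sum>i<Suc j. G $$ (i, t) * w $ i) =
        vec n (\<lambda>t. \<Sum>i<j. G $$ (i, t) * w $ i) + w $ j \<cdot>\<^sub>v row G j"
      using Suc.prems G by (intro eq_vecI) (auto simp: mult.commute)
    moreover have "w $ j \<cdot>\<^sub>v row G j \<in> C"
      using smult_closed[of "w $ j" "row G j"] rows Suc.prems
      by (simp add: module_vec_simps class_ring_simps)
    ultimately show ?case
      using m_closed[of "vec n (\<lambda>t. \<Sum>i<j. G $$ (i, t) * w $ i)" "w $ j \<cdot>\<^sub>v row G j"] Suc
      by (simp add: module_vec_simps)
  qed
  moreover have "transpose_mat G *\<^sub>v w = vec n (\<lambda>t. \<Sum>i<k. G $$ (i, t) * w $ i)"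
    using G w by (intro eq_vecI) (auto simp: scalar_prod_def lessThan_atLeast0)
  ultimately show ?thesis
    by simp
qed

text \<open>Orthogonal complements are submodules. So orthogonality of the rows passes to their span
  in one argument, and, after exchanging the arguments, in the other.\<close>

lemma self_orthogonal_row_code_iff:
  fixes M :: "'a::comm_ring_1 mat"
  assumes M: "M \<in> carrier_mat k l"
  shows "self_orthogonal (row_code M) \<longleftrightarrow> M * transpose_mat M = 0\<^sub>m k k"
proof -
  interpret vec_module "TYPE('a)" l .
  have code: "row_code M = span (set (rows M))"
    using M by (simp add: row_code_def)
  have rows: "set (rows M) = row M ` {..<k}"
    using M by (auto simp: rows_def)
  have carr: "set (rows M) \<subseteq> carrier_vec l"
    using M by (auto simp: rows)
  have prod: "(M * transpose_mat M) $$ (i, j) = row M i \<bullet> row M j" if "i < k" "j < k" for i j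
    using M that by simp
  have sub: "submodule class_ring {x \<in> carrier_vec l. \<forall>y\<in>Y. x \<bullet> y = 0} V"
    if Y: "Y \<subseteq> carrier_vec l" for Y
  proof -
    have "(v + w) \<bullet> y = v \<bullet> y + w \<bullet> y" if "v \<in> carrier_vec l" "w \<in> carrier_vec l" "y \<in> Y" for v w y
      using that Y by (intro add_scalar_prod_distrib) auto
    moreover have "(a \<cdot>\<^sub>v v) \<bullet> y = a * (v \<bullet> y)" if "v \<in> carrier_vec l" "y \<in> Y" for a v y
      using that Y by auto
    ultimately show ?thesis
      using Y module_axioms
      by (intro submodule.intro) (auto simp: module_vec_simps subset_iff)
  qed
  show ?thesis
  proof
    assume so: "self_orthogonal (row_code M)"
    have "row M i \<in> row_code M" if "i < k" for i
      using in_own_span[OF carr] that by (auto simp: code rows)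
    then have "row M i \<bullet> row M j = 0" if "i < k" "j < k" for i j
      using so that by (auto simp: self_orthogonal_def)
    then show "M * transpose_mat M = 0\<^sub>m k k"
      using M prod by (intro eq_matI) (auto simp del: index_mult_mat(1))
  next
    assume "M * transpose_mat M = 0\<^sub>m k k"
    then have orth: "row M i \<bullet> row M j = 0" if "i < k" "j < k" for i j
      using prod[OF that] that by simp
    have "row_code M \<subseteq> {x \<in> carrier_vec l. \<forall>y\<in>set (rows M). x \<bullet> y = 0}"
      unfolding code by (rule span_is_subset[OF _ sub[OF carr]]) (use carr orth in \<open>auto simp: rows\<close>)
    then have *: "x \<in> carrier_vec l" "\<forall>y\<in>set (rows M). x \<bullet> y = 0" if "x \<in> row_code M" for x
      using that by auto
    then have sub': "row_code M \<subseteq> carrier_vec l"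
      by blast
    have "row_code M \<subseteq> {x \<in> carrier_vec l. \<forall>y\<in>row_code M. x \<bullet> y = 0}"
      unfolding code
    proof (rule span_is_subset[OF _ sub])
      show "set (rows M) \<subseteq> {x \<in> carrier_vec l. \<forall>y\<in>span (set (rows M)). x \<bullet> y = 0}"
      proof (intro subsetI CollectI conjI ballI)
        fix x y assume "x \<in> set (rows M)" "y \<in> span (set (rows M))"
        then have "x \<in> carrier_vec l" "y \<in> carrier_vec l" "y \<bullet> x = 0"
          using carr * unfolding code by blast+
        then show "x \<bullet> y = 0"
          by (simp add: comm_scalar_prod[of x l y])
      qed (use carr in blast)
    qed (use sub' code in simp)
    then show "self_orthogonal (row_code M)"
      by (auto simp: self_orthogonal_def)
  qed
qed

lemma append_cols_mult_transpose:
  fixes G B :: "'a::comm_ring_1 mat"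
  assumes G: "G \<in> carrier_mat k n" and B: "B \<in> carrier_mat k m"
  shows "append_cols G B \<in> carrier_mat k (n + m)"
    "append_cols G B * transpose_mat (append_cols G B) =
      G * transpose_mat G + B * transpose_mat B"
proof -
  show *: "append_cols G B \<in> carrier_mat k (n + m)"
    using G B by (auto simp: append_cols_def)
  have row: "row (append_cols G B) i = row G i @\<^sub>v row B i" if "i < k" for i
    unfolding append_cols_def by (rule row_four_block_mat(1)[OF G B _ _ that]) (use G B in auto)
  have "(row G i @\<^sub>v row B i) \<bullet> (row G j @\<^sub>v row B j) = row G i \<bullet> row G j + row B i \<bullet> row B j"
    if "i < k" "j < k" for i j
    by (rule scalar_prod_append[of _ n _ m]) (use G B in auto)
  then show "append_cols G B * transpose_mat (append_cols G B) =
      G * transpose_mat G + B * transpose_mat B"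
    using * G B row by (intro eq_matI) auto
qed

lemma mult_congruence:
  fixes P B :: "'a::comm_ring_1 mat"
  assumes "P \<in> carrier_mat k' k" "B \<in> carrier_mat k m"
  shows "P * B * transpose_mat (P * B) = P * (B * transpose_mat B) * transpose_mat P"
  using assms by (simp add: transpose_mult[of P k' k B m] assoc_mult_mat[of P k' k B m _ k']
      assoc_mult_mat[of P k' k _ k _ k'] assoc_mult_mat[of B k m _ k _ k'])

lemma self_orthogonal_embedding_iff:
  fixes C :: "'a::comm_ring_1 dual vec set"
  assumes two: "(1::'a) + 1 = 0" and G: "generator_matrix n C k1 k2 G"
  shows "(\<exists>D. self_orthogonal_embedding n C l D) \<longleftrightarrow>
    (\<exists>m. l = n + m \<and>
      (\<exists>B\<in>carrier_mat (k1 + k2) m. B * transpose_mat B = G * transpose_mat G))"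
    (is "?L \<longleftrightarrow> ?R")
proof -
  have two': "(1::'a dual) + 1 = 0"
    by (rule dual_char_two[OF two])
  have so: "self_orthogonal (row_code (append_cols G' B)) \<longleftrightarrow>
      B * transpose_mat B = G' * transpose_mat G'"
    if "G' \<in> carrier_mat k n" "B \<in> carrier_mat k m" for G' B :: "'a dual mat" and k m
  proof -
    have "x + y = 0 \<longleftrightarrow> y = x" for x y :: "'a dual"
      using char_two_minus[OF two', of x] by (metis eq_neg_iff_add_eq_0 add.commute)
    then show ?thesis
      unfolding self_orthogonal_row_code_iff[OF append_cols_mult_transpose(1)[OF that]]
        append_cols_mult_transpose(2)[OF that]
      using that by (auto simp: mat_eq_iff)
  qed
  have G_carr: "G \<in> carrier_mat (k1 + k2) n" and G_rows: "\<And>i. i < k1 + k2 \<Longrightarrow> row G i \<in> C"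
    using G by (auto simp: generator_matrix_def)
  show ?thesis
  proof
    assume ?L
    then obtain k1' k2' m G' B' where G': "generator_matrix n C k1' k2' G'"
      and B': "B' \<in> carrier_mat (k1' + k2') m" and l: "l = n + m"
      and self: "self_orthogonal (row_code (append_cols G' B'))"
      unfolding self_orthogonal_embedding_def by blast
    have G'_carr: "G' \<in> carrier_mat (k1' + k2') n"
      using G' by (simp add: generator_matrix_def)
    have "\<exists>w\<in>carrier_vec (k1' + k2'). row G i = transpose_mat G' *\<^sub>v w" if "i < k1 + k2" for i
      using G' G_rows[OF that] unfolding generator_matrix_def by blast
    then obtain w where w: "\<And>i. i < k1 + k2 \<Longrightarrow> w i \<in> carrier_vec (k1' + k2')"
      "\<And>i. i < k1 + k2 \<Longrightarrow> row G i = transpose_mat G' *\<^sub>v w i"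
      by metis
    \<comment> \<open>Row \<open>i\<close> of \<open>M\<close> holds the coefficients of row
      \<open>i\<close> of \<open>G\<close> in terms of \<open>G'\<close>. \<open>M\<close> may be
      rectangular; it carries \<open>B'\<close> over to an extension of \<open>G\<close> with the
      same number of columns.\<close>
    define M where "M = mat (k1 + k2) (k1' + k2') (\<lambda>(i, j). w i $ j)"
    have M: "M \<in> carrier_mat (k1 + k2) (k1' + k2')"
      by (simp add: M_def)
    have "G = M * G'"
    proof (rule eq_matI)
      fix i j assume "i < dim_row (M * G')" "j < dim_col (M * G')"
      then have ij: "i < k1 + k2" "j < n"
        using M G'_carr by auto
      have "row M i = w i"
        using ij w(1)[OF ij(1)] by (intro eq_vecI) (auto simp: M_def)
      moreover have "G $$ (i, j) = row G i $ j"
        using ij G_carr by simp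
      ultimately show "G $$ (i, j) = (M * G') $$ (i, j)"
        using ij M G'_carr w[OF ij(1)] by (simp add: comm_scalar_prod[of _ "k1' + k2'"])
    qed (use G_carr G'_carr M in auto)
    then have "M * B' * transpose_mat (M * B') = G * transpose_mat G"
      using self so[OF G'_carr B'] mult_congruence[OF M B'] mult_congruence[OF M G'_carr] by simp
    moreover have "M * B' \<in> carrier_mat (k1 + k2) m"
      using M B' by simp
    ultimately show ?R
      using l by blast
  next
    assume ?R
    then obtain m B where "l = n + m" "B \<in> carrier_mat (k1 + k2) m"
      "B * transpose_mat B = G * transpose_mat G"
      by blast
    then have "self_orthogonal_embedding n C l (row_code (append_cols G B))"
      using so[OF G_carr] G unfolding self_orthogonal_embedding_def by blast
    then show ?L
      by blast
  qed
qed

lemma gram_like_mult_transpose: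
  fixes G :: "'a::comm_ring_1 dual mat"
  assumes two: "(1::'a) + 1 = 0" and G: "G \<in> carrier_mat k n"
  shows "gram_like k (G * transpose_mat G)"
proof -
  have "upart (x * x) = 0" for x :: "'a dual"
    using char_two_add_self[OF two, of "res x * upart x"] by (simp add: mult.commute)
  then show ?thesis
    using G by (auto simp: gram_like_def scalar_prod_def mult.commute simp del: dual_simps(16))
qed

text \<open>\<open>B\<close> goes to \<open>P * B\<close> and back by \<open>Q\<close>, with
  \<open>m\<close> unchanged, so only the congruence class of the Gram matrix matters.\<close>

lemma ex_mult_transpose_congruent:
  fixes A :: "'a::comm_ring_1 mat"
  assumes A: "A \<in> carrier_mat k k" and P: "P \<in> carrier_mat k k" and Q: "Q \<in> carrier_mat k k"
    and QP: "Q * P = 1\<^sub>m k"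
  shows "(\<exists>B\<in>carrier_mat k m. B * transpose_mat B = A) \<longleftrightarrow>
    (\<exists>B\<in>carrier_mat k m. B * transpose_mat B = P * A * transpose_mat P)"
proof
  assume "\<exists>B\<in>carrier_mat k m. B * transpose_mat B = A"
  then obtain B where B: "B \<in> carrier_mat k m" "B * transpose_mat B = A"
    by blast
  then show "\<exists>B\<in>carrier_mat k m. B * transpose_mat B = P * A * transpose_mat P"
    using P mult_congruence[OF P B(1)] by (intro bexI[of _ "P * B"]) auto
next
  assume "\<exists>B\<in>carrier_mat k m. B * transpose_mat B = P * A * transpose_mat P"
  then obtain B where B: "B \<in> carrier_mat k m" "B * transpose_mat B = P * A * transpose_mat P"
    by blast
  have "transpose_mat P * transpose_mat Q = 1\<^sub>m k"
    using QP P Q by (metis transpose_mult transpose_one)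
  moreover have "Q * (P * A * transpose_mat P) * transpose_mat Q =
      (Q * P) * A * (transpose_mat P * transpose_mat Q)"
    using P Q A by (simp add: assoc_mult_mat[of _ k k _ k _ k])
  ultimately have "Q * B * transpose_mat (Q * B) = A"
    using mult_congruence[OF Q B(1)] B(2) QP A by simp
  then show "\<exists>B\<in>carrier_mat k m. B * transpose_mat B = A"
    using Q B(1) by (intro bexI[of _ "Q * B"]) auto
qed

lemma ex_mult_transpose_monomial_iff:
  "(\<exists>B\<in>carrier_mat k m. B * transpose_mat B = monomial_mat k \<pi> c) \<longleftrightarrow>
    (\<exists>b. realizes m {..<k} \<pi> c b)"
proof
  assume "\<exists>B\<in>carrier_mat k m. B * transpose_mat B = monomial_mat k \<pi> c"
  then obtain B where B: "B \<in> carrier_mat k m" "B * transpose_mat B = monomial_mat k \<pi> c"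
    by blast
  have "dot m (\<lambda>t. B $$ (i, t)) (\<lambda>t. B $$ (j, t)) = (if j = \<pi> i then c i else 0)"
    if "i < k" "j < k" for i j
    using arg_cong[OF B(2), of "\<lambda>M. M $$ (i, j)"] B(1) that
    by (simp add: dot_def monomial_mat_def scalar_prod_def lessThan_atLeast0)
  then have "realizes m {..<k} \<pi> c (\<lambda>i t. B $$ (i, t))"
    by (simp add: realizes_def)
  then show "\<exists>b. realizes m {..<k} \<pi> c b"
    by blast
next
  assume "\<exists>b. realizes m {..<k} \<pi> c b"
  then obtain b where b: "realizes m {..<k} \<pi> c b"
    by blast
  show "\<exists>B\<in>carrier_mat k m. B * transpose_mat B = monomial_mat k \<pi> c"
    using b by (intro bexI[of _ "mat k m (\<lambda>(i, t). b i t)"] eq_matI)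
      (auto simp: realizes_def dot_def monomial_mat_def scalar_prod_def lessThan_atLeast0)
qed

section \<open>The invariants \<open>r\<close> and \<open>\<rho>\<close>\<close>

text \<open>Counting images: multiplying by \<open>Y\<close> on the right can only shrink the image,
  and applying \<open>X\<close> cannot increase its cardinality.\<close>

lemma rank_mult_le:
  fixes A :: "'f::{field,finite} mat"
  assumes A: "A \<in> carrier_mat n m" and X: "X \<in> carrier_mat n' n" and Y: "Y \<in> carrier_mat m m'"
  shows "vec_space.rank n' (X * A * Y) \<le> vec_space.rank n A"
proof -
  have "(*\<^sub>v) (X * A * Y) ` carrier_vec m' \<subseteq> (*\<^sub>v) X ` ((*\<^sub>v) A ` carrier_vec m)"
  proof
    fix z assume "z \<in> (*\<^sub>v) (X * A * Y) ` carrier_vec m'"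
    then obtain v where v: "v \<in> carrier_vec m'" "z = X * A * Y *\<^sub>v v"
      by blast
    then have "z = X *\<^sub>v (A *\<^sub>v (Y *\<^sub>v v))"
      using A X Y by (simp add: assoc_mult_mat_vec[of X n' n _ m'] assoc_mult_mat_vec[of A n m _ m'])
    moreover have "Y *\<^sub>v v \<in> carrier_vec m"
      using Y v by simp
    ultimately show "z \<in> (*\<^sub>v) X ` ((*\<^sub>v) A ` carrier_vec m)"
      by blast
  qed
  then have "card ((*\<^sub>v) (X * A * Y) ` carrier_vec m') \<le> card ((*\<^sub>v) X ` ((*\<^sub>v) A ` carrier_vec m))"
    by (intro card_mono) auto
  also have "\<dots> \<le> card ((*\<^sub>v) A ` carrier_vec m)"
    by (intro card_image_le) auto
  finally have "CARD('f) ^ vec_space.rank n' (X * A * Y) \<le> CARD('f) ^ vec_space.rank n A"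
    using card_mat_image_eq_rank[OF A] card_mat_image_eq_rank[of "X * A * Y" n' m'] A X Y by simp
  then show ?thesis
    by (rule power_le_imp_le_exp[OF card_field_gt_1])
qed

text \<open>Since \<pi> merely permutes coordinates, the image consists of all vectors supported on
  the indices with \<open>d i = 1\<close>.\<close>

lemma rank_monomial_mat:
  fixes d :: "nat \<Rightarrow> 'f::{field,finite}"
  assumes pi: "\<And>i. i < k \<Longrightarrow> \<pi> i < k \<and> \<pi> (\<pi> i) = i"
    and d: "\<And>i. i < k \<Longrightarrow> d i = 0 \<or> d i = 1"
  shows "vec_space.rank k (monomial_mat k \<pi> d) = card {i. i < k \<and> d i = 1}"
proof -
  let ?D = "{i. i < k \<and> d i = 1}"
  have M: "monomial_mat k \<pi> d \<in> carrier_mat k k"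
    by (simp add: monomial_mat_def)
  have mult: "monomial_mat k \<pi> d *\<^sub>v v = vec k (\<lambda>i. d i * v $ \<pi> i)" if "v \<in> carrier_vec k" for v
    using that pi by (intro eq_vecI) (auto simp: monomial_mat_def scalar_prod_def
        if_distrib[of "\<lambda>z. z * _"] cong: if_cong)
  let ?f = "\<lambda>x :: nat \<Rightarrow> 'f. vec k (\<lambda>i. if d i = 1 then x i else 0)"
  have "(*\<^sub>v) (monomial_mat k \<pi> d) ` carrier_vec k = ?f ` (?D \<rightarrow>\<^sub>E UNIV)"
  proof (intro equalityI subsetI)
    fix z assume "z \<in> (*\<^sub>v) (monomial_mat k \<pi> d) ` carrier_vec k"
    then obtain v where v: "v \<in> carrier_vec k" "z = vec k (\<lambda>i. d i * v $ \<pi> i)"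
      using mult by auto
    then have "z = ?f (\<lambda>i\<in>?D. v $ \<pi> i)"
      using d by (intro eq_vecI) auto
    then show "z \<in> ?f ` (?D \<rightarrow>\<^sub>E UNIV)"
      by (rule image_eqI[of z ?f "\<lambda>i\<in>?D. v $ \<pi> i"]) simp
  next
    fix z assume "z \<in> ?f ` (?D \<rightarrow>\<^sub>E UNIV)"
    then obtain x where x: "z = ?f x"
      by blast
    have "z = monomial_mat k \<pi> d *\<^sub>v vec k (\<lambda>i. x (\<pi> i))"
    proof -
      have "d i = 0" if "i < k" "d i \<noteq> 1" for i
        using d[OF that(1)] that(2) by blast
      then show ?thesis
        unfolding x using pi by (subst mult) (auto intro!: eq_vecI)
    qed
    then show "z \<in> (*\<^sub>v) (monomial_mat k \<pi> d) ` carrier_vec k"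
      by auto
  qed
  moreover have "inj_on ?f (?D \<rightarrow>\<^sub>E UNIV)"
  proof (rule inj_onI)
    fix x y :: "nat \<Rightarrow> 'f" assume xy: "x \<in> ?D \<rightarrow>\<^sub>E UNIV" "y \<in> ?D \<rightarrow>\<^sub>E UNIV" and eq: "?f x = ?f y"
    have "x i = y i" if "i \<in> ?D" for i
      using arg_cong[OF eq, of "\<lambda>v. v $ i"] that by simp
    then show "x = y"
      by (rule PiE_ext[OF xy])
  qed
  ultimately have "card ((*\<^sub>v) (monomial_mat k \<pi> d) ` carrier_vec k) = card (?D \<rightarrow>\<^sub>E (UNIV :: 'f set))"
    by (simp add: card_image)
  then have "CARD('f) ^ vec_space.rank k (monomial_mat k \<pi> d) = CARD('f) ^ card ?D"
    using card_mat_image_eq_rank[OF M] by (simp add: card_PiE)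
  then show ?thesis
    using card_field_gt_1[where 'f = 'f] by (metis power_inject_exp)
qed

lemma rank_congruent:
  fixes A :: "'f::{field,finite} mat"
  assumes A: "A \<in> carrier_mat k k" and P: "P \<in> carrier_mat k k" and Q: "Q \<in> carrier_mat k k"
    and QP: "Q * P = 1\<^sub>m k"
  shows "vec_space.rank k (P * A * transpose_mat P) = vec_space.rank k A"
proof (rule antisym)
  show "vec_space.rank k (P * A * transpose_mat P) \<le> vec_space.rank k A"
    by (rule rank_mult_le[OF A P]) (use P in simp)
  have "transpose_mat P * transpose_mat Q = 1\<^sub>m k"
    using QP P Q by (metis transpose_mult transpose_one)
  moreover have "Q * (P * A * transpose_mat P) * transpose_mat Q =
      (Q * P) * A * (transpose_mat P * transpose_mat Q)"
    using P Q A by (simp add: assoc_mult_mat[of _ k k _ k _ k])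
  ultimately have "A = Q * (P * A * transpose_mat P) * transpose_mat Q"
    using QP A by simp
  then show "vec_space.rank k A \<le> vec_space.rank k (P * A * transpose_mat P)"
    using rank_mult_le[of "P * A * transpose_mat P" k k Q k "transpose_mat Q" k] P Q A by simp
qed

lemma index_mult_mat_sum:
  assumes "X \<in> carrier_mat a b" "Y \<in> carrier_mat b c" "i < a" "j < c"
  shows "(X * Y) $$ (i, j) = (\<Sum>l<b. X $$ (i, l) * Y $$ (l, j))"
  using assms by (simp add: scalar_prod_def lessThan_atLeast0)

lemma map_mat_res_mult:
  fixes X Y :: "'a::comm_ring_1 dual mat"
  assumes "X \<in> carrier_mat k m" "Y \<in> carrier_mat m n"
  shows "map_mat res (X * Y) = map_mat res X * map_mat res Y"
  using assms by (intro eq_matI) (auto simp: scalar_prod_def)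

lemma map_mat_res_one:
  "map_mat res (1\<^sub>m k :: 'a::comm_ring_1 dual mat) = 1\<^sub>m k"
  by (intro eq_matI) auto

lemma map_mat_upart_mult:
  fixes X Y :: "'a::comm_ring_1 dual mat"
  assumes "X \<in> carrier_mat k m" "Y \<in> carrier_mat m n"
  shows "map_mat upart (X * Y) = map_mat res X * map_mat upart Y + map_mat upart X * map_mat res Y"
  using assms by (intro eq_matI) (auto simp: scalar_prod_def sum.distrib)

section \<open>The form induced on the radical\<close>

text \<open>The rank of the form on the radical is computed from these facts about \<open>N\<close>
  alone, so it does not depend on the chosen basis.\<close>

lemma rows_form_basis_Rad:
  fixes A :: "'f::field mat"
  assumes A: "A \<in> carrier_mat k k" and N: "rows_form_basis k N (Rad A)" and t: "dim_row N = t"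
  shows "N \<in> carrier_mat t k" "N * A = 0\<^sub>m t k"
    "\<And>x. x \<in> Rad A \<Longrightarrow> \<exists>y\<in>carrier_vec t. x = transpose_mat N *\<^sub>v y"
proof -
  have At: "transpose_mat A \<in> carrier_mat k k"
    using A by simp
  interpret kernel k k "transpose_mat A"
    by unfold_locales (rule At)
  show N_carr: "N \<in> carrier_mat t k"
    using N t by (auto simp: rows_form_basis_def)
  have basis: "basis (set (rows N))"
    using N unfolding rows_form_basis_def Rad_def by blast
  then have sub: "set (rows N) \<subseteq> mat_kernel (transpose_mat A)"
    and span: "span (set (rows N)) = mat_kernel (transpose_mat A)"
    unfolding Ker.basis_def by auto
  have "transpose_mat A *\<^sub>v row N i = 0\<^sub>v k" if "i < t" for i
  proof -
    have "row N i \<in> set (rows N)"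
      using that t by (simp add: rows_def)
    then show ?thesis
      using sub mat_kernelD(2)[OF At] by blast
  qed
  then have "(N * A) $$ (i, j) = 0" if "i < t" "j < k" for i j
  proof -
    have "(N * A) $$ (i, j) = (transpose_mat A *\<^sub>v row N i) $ j"
      using that A N_carr by (simp add: comm_scalar_prod[of _ k])
    then show ?thesis
      using that \<open>\<And>i. i < t \<Longrightarrow> transpose_mat A *\<^sub>v row N i = 0\<^sub>v k\<close> by simp
  qed
  then show "N * A = 0\<^sub>m t k"
    using A N_carr by (intro eq_matI) auto
  show "\<exists>y\<in>carrier_vec t. x = transpose_mat N *\<^sub>v y" if "x \<in> Rad A" for x
  proof -
    have "x \<in> NC.row_space N"
      using that span span_same[OF sub] by (simp add: Rad_def NC.row_space_def)
    then show ?thesis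
      unfolding NC.row_space_eq[OF N_carr] using t by auto
  qed
qed

text \<open>The normal form supplies another matrix \<open>N'\<close> with rows in the radical, for
  which the u-part of the form is visible. \<open>N\<close> and \<open>N'\<close> are left multiples
  of each other, so \<open>rank_mult_le\<close> gives both inequalities.\<close>

lemma rank_radical_form:
  fixes A P Q :: "'f::{field,finite} dual mat"
  assumes A: "A \<in> carrier_mat k k" and sym: "transpose_mat A = A"
    and P: "P \<in> carrier_mat k k" and Q: "Q \<in> carrier_mat k k"
    and PQ: "P * Q = 1\<^sub>m k" "Q * P = 1\<^sub>m k"
    and pair: "pairing {..<k} \<pi> c" and nf: "P * A * transpose_mat P = monomial_mat k \<pi> c"
    and N: "rows_form_basis k N (Rad (map_mat res A))"
  shows "vec_space.rank (dim_row N) (N * map_mat upart A * transpose_mat N) = card {i. i < k \<and> c i = uu}"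
proof -
  define A0 A1 where "A0 = map_mat res A" and "A1 = map_mat upart A"
  define P0 P1 Q0 where "P0 = map_mat res P" and "P1 = map_mat upart P" and "Q0 = map_mat res Q"
  define E F where "E = monomial_mat k \<pi> (\<lambda>i. res (c i))" and "F = monomial_mat k \<pi> (\<lambda>i. upart (c i))"
  \<comment> \<open>The diagonal projection onto the indices whose value is not a unit.\<close>
  define Z :: "'f mat" where "Z = monomial_mat k (\<lambda>i. i) (\<lambda>i. if c i = 1 then 0 else 1)"
  define t where "t = dim_row N"
  note carr = A P Q
  have A0: "A0 \<in> carrier_mat k k" and A1: "A1 \<in> carrier_mat k k" and P0: "P0 \<in> carrier_mat k k"
    and P1: "P1 \<in> carrier_mat k k" and Q0: "Q0 \<in> carrier_mat k k"
    using carr by (auto simp: A0_def A1_def P0_def P1_def Q0_def)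
  have E: "E \<in> carrier_mat k k" and F: "F \<in> carrier_mat k k" and Z: "Z \<in> carrier_mat k k"
    by (auto simp: E_def F_def Z_def monomial_mat_def)
  note carr' = A0 A1 P0 P1 Q0 E F Z
  note assoc = assoc_mult_mat[of _ _ k _ k _ k]
  have pi: "\<pi> i < k" "\<pi> (\<pi> i) = i" "c (\<pi> i) = c i" "c i = 1 \<or> c i = uu \<or> c i = 0" if "i < k" for i
    using pair that by (auto simp: pairing_def)
  have uu_neq: "(uu :: 'f dual) \<noteq> 1" "(0 :: 'f dual) \<noteq> 1" "(0 :: 'f dual) \<noteq> uu"
    by (metis dual_simps zero_neq_one)+
  have PQ0: "Q0 * P0 = 1\<^sub>m k"
    using map_mat_res_mult[OF Q P] PQ by (simp add: P0_def Q0_def map_mat_res_one)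
  then have PQ0t: "transpose_mat P0 * transpose_mat Q0 = 1\<^sub>m k"
    using P0 Q0 by (metis transpose_mult transpose_one)
  have map_t: "map_mat f (transpose_mat X) = transpose_mat (map_mat f X)"
    for f :: "'f dual \<Rightarrow> 'f" and X
    by (intro eq_matI) auto
  have symA0: "transpose_mat A0 = A0"
    using sym by (metis A0_def map_t)
  have resnf: "P0 * A0 * transpose_mat P0 = E"
  proof -
    have "map_mat res (monomial_mat k \<pi> c) = E"
      by (intro eq_matI) (auto simp: E_def monomial_mat_def)
    moreover have "map_mat res (P * A * transpose_mat P) = P0 * A0 * transpose_mat P0"
      using carr by (simp add: map_mat_res_mult[of _ k k _ k] P0_def A0_def map_t)
    ultimately show ?thesis
      by (simp add: nf)
  qed
  have upartnf: "P0 * A0 * transpose_mat P1 + (P0 * A1 + P1 * A0) * transpose_mat P0 = F"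
  proof -
    have "map_mat upart (monomial_mat k \<pi> c) = F"
      by (intro eq_matI) (auto simp: F_def monomial_mat_def)
    moreover have "map_mat upart (P * A * transpose_mat P) =
        P0 * A0 * transpose_mat P1 + (P0 * A1 + P1 * A0) * transpose_mat P0"
      using carr by (simp add: map_mat_res_mult[of _ k k _ k] map_mat_upart_mult[of _ k k _ k]
          P0_def P1_def A0_def A1_def map_t del: assoc_mult_mat)
    ultimately show ?thesis
      by (simp add: nf)
  qed
  have Zl: "Z * X = mat k k (\<lambda>(i, j). if c i = 1 then 0 else X $$ (i, j))"
    if "X \<in> carrier_mat k k" for X
    using that by (intro eq_matI) (auto simp: Z_def monomial_mat_def scalar_prod_def
        if_distrib[of "\<lambda>z. z * _"] cong: if_cong)
  have ZE: "Z * E = 0\<^sub>m k k"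
  proof -
    have "res (c i) = 0" if "i < k" "c i \<noteq> 1" for i
      using pi(4)[OF that(1)] that(2) by auto
    then show ?thesis
      unfolding Zl[OF E] by (intro eq_matI) (auto simp: E_def monomial_mat_def)
  qed
  have ZF: "Z * F = F"
    using pi uu_neq unfolding Zl[OF F] by (intro eq_matI) (auto simp: F_def monomial_mat_def)
  have Zt: "transpose_mat Z = Z"
    by (intro eq_matI) (auto simp: Z_def monomial_mat_def)
  have Ft: "transpose_mat F = F"
    using pi by (intro eq_matI) (auto simp: F_def monomial_mat_def)
  have FZ: "F * Z = F"
    using ZF Zt Ft Z F by (metis transpose_mult)
  \<comment> \<open>\<open>N'\<close> keeps the rows of \<open>P0\<close> at non-unit indices and
    replaces the others by 0; it need not be a basis, but its rows span the radical.\<close>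
  define N' where "N' = Z * P0"
  have N': "N' \<in> carrier_mat k k"
    using Z P0 by (simp add: N'_def)
  have "N' * A0 = Z * (P0 * A0 * transpose_mat P0) * transpose_mat Q0"
    using carr' PQ0t by (simp add: N'_def assoc)
  then have N'A0: "N' * A0 = 0\<^sub>m k k"
    using resnf ZE Q0 by simp
  have A0N': "A0 * transpose_mat N' = 0\<^sub>m k k"
    using arg_cong[OF N'A0, of transpose_mat] transpose_mult[OF N' A0] symA0 by simp
  have N't: "transpose_mat N' = transpose_mat P0 * Z"
    using transpose_mult[OF Z P0] Zt by (simp add: N'_def)
  have F_eq: "N' * A1 * transpose_mat N' = F"
  proof -
    \<comment> \<open>Of the three terms in the u-part of the congruence, those containing
      \<open>A0\<close> vanish because \<open>A0\<close> is killed by \<open>N'\<close> on the left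
      and by its transpose on the right.\<close>
    have "F = Z * (P0 * A0 * transpose_mat P1 + (P0 * A1 + P1 * A0) * transpose_mat P0) * Z"
      using upartnf ZF FZ by simp
    also have "\<dots> = N' * A0 * (transpose_mat P1 * Z) + N' * A1 * (transpose_mat P0 * Z)
        + Z * P1 * (A0 * (transpose_mat P0 * Z))"
      using carr' by (simp add: N'_def assoc add_mult_distrib_mat[of _ k k _ _ k]
          mult_add_distrib_mat[of _ k k _ k] assoc_add_mat[of _ k k])
    also have "\<dots> = N' * A1 * transpose_mat N'"
      using N'A0 A0N' carr' N' by (simp add: N't[symmetric])
    finally show ?thesis ..
  qed
  have N_carr: "N \<in> carrier_mat t k" and NA0: "N * A0 = 0\<^sub>m t k"
    and N_span: "\<And>x. x \<in> Rad A0 \<Longrightarrow> \<exists>y\<in>carrier_vec t. x = transpose_mat N *\<^sub>v y"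
    using rows_form_basis_Rad[OF A0 N[folded A0_def] t_def[symmetric]] by auto
  have sandwich: "X * Y * A1 * transpose_mat (X * Y) = X * (Y * A1 * transpose_mat Y) * transpose_mat X"
    if "X \<in> carrier_mat a b" "Y \<in> carrier_mat b k" for X Y a b
    using that A1 by (simp add: transpose_mult[of X a b Y k] assoc_mult_mat[of X a b Y k _ k]
        assoc_mult_mat[of _ a k _ k _ a] assoc_mult_mat[of _ a b _ b _ a]
        assoc_mult_mat[of _ b k _ k _ a] assoc_mult_mat[of _ b k _ b _ a]
        assoc_mult_mat[of X a b _ k _ a] assoc_mult_mat[of X a b _ b _ a])
  have rank_F: "vec_space.rank k F = card {i. i < k \<and> c i = uu}"
  proof -
    have "{i. i < k \<and> upart (c i) = 1} = {i. i < k \<and> c i = uu}"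
    proof -
      have "upart (c i) = 1 \<longleftrightarrow> c i = uu" if "i < k" for i
        using pi(4)[OF that] uu_neq by auto
      then show ?thesis
        by blast
    qed
    then show ?thesis
    proof -
      have "upart (c i) = 0 \<or> upart (c i) = 1" if "i < k" for i
        using pi(4)[OF that] by auto
      then have "vec_space.rank k F = card {i. i < k \<and> upart (c i) = 1}"
        unfolding F_def by (intro rank_monomial_mat) (use pi in auto)
      then show ?thesis
        by (simp only: \<open>{i. i < k \<and> upart (c i) = 1} = {i. i < k \<and> c i = uu}\<close>)
    qed
  qed
  \<comment> \<open>In the new coordinates \<open>N * Q0\<close> the columns at unit indices vanish:
    \<open>N * Q0 * E\<close> is 0, and \<open>E\<close> has the entry 1 at
    \<open>(j, \<pi> j)\<close> for each unit index \<open>j\<close>. So \<open>Z\<close> leaves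
    \<open>N * Q0\<close> unchanged.\<close>
  have "N = N * Q0 * N'"
  proof -
    have "N * Q0 * E = N * A0 * transpose_mat P0"
    proof -
      have "N * Q0 * E = N * (Q0 * P0) * A0 * transpose_mat P0"
        using carr' N_carr by (simp add: resnf[symmetric] assoc)
      then show ?thesis
        using PQ0 N_carr by simp
    qed
    then have zero: "N * Q0 * E = 0\<^sub>m t k"
      using NA0 P0 by simp
    have NQ0: "N * Q0 \<in> carrier_mat t k"
      using N_carr Q0 by simp
    have col: "(N * Q0) $$ (i, j) = 0" if ij: "i < t" "j < k" "c j = 1" for i j
    proof -
      have "(N * Q0 * E) $$ (i, \<pi> j) = (\<Sum>l<k. (N * Q0) $$ (i, l) * E $$ (l, \<pi> j))"
        by (rule index_mult_mat_sum[OF NQ0 E ij(1) pi(1)[OF ij(2)]])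
      also have "\<dots> = (\<Sum>l<k. if l = j then (N * Q0) $$ (i, j) else 0)"
      proof (rule sum.cong[OF refl])
        fix l assume "l \<in> {..<k}"
        moreover from this have "\<pi> j = \<pi> l \<longleftrightarrow> l = j"
          using pi(2) ij by (metis lessThan_iff)
        ultimately show "(N * Q0) $$ (i, l) * E $$ (l, \<pi> j) = (if l = j then (N * Q0) $$ (i, j) else 0)"
          using pi[OF ij(2)] ij by (simp add: E_def monomial_mat_def)
      qed
      finally show ?thesis
        using zero ij pi[OF ij(2)] by simp
    qed
    have "N * Q0 * Z = N * Q0"
    proof (rule eq_matI)
      fix i j assume "i < dim_row (N * Q0)" "j < dim_col (N * Q0)"
      then have ij: "i < t" "j < k"
        using NQ0 by auto
      have "(N * Q0 * Z) $$ (i, j) = (\<Sum>l<k. (N * Q0) $$ (i, l) * Z $$ (l, j))"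
        by (rule index_mult_mat_sum[OF NQ0 Z ij])
      also have "\<dots> = (\<Sum>l<k. if l = j then (N * Q0) $$ (i, l) else 0)"
        using ij col by (intro sum.cong) (auto simp: Z_def monomial_mat_def)
      finally show "(N * Q0 * Z) $$ (i, j) = (N * Q0) $$ (i, j)"
        using ij by simp
    qed (use NQ0 Z in auto)
    then have "N * Q0 * N' = N * Q0 * P0"
      using assoc_mult_mat[OF NQ0 Z P0] by (simp add: N'_def)
    also have "\<dots> = N"
      using PQ0 N_carr assoc_mult_mat[OF N_carr Q0 P0] by simp
    finally show ?thesis ..
  qed
  then have "N * A1 * transpose_mat N = N * Q0 * F * transpose_mat (N * Q0)"
    using sandwich[of "N * Q0" t k N'] N_carr Q0 N' F_eq by simp
  then have le: "vec_space.rank t (N * A1 * transpose_mat N) \<le> vec_space.rank k F"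
    using rank_mult_le[OF F, of "N * Q0" t "transpose_mat (N * Q0)" t] N_carr Q0 by simp
  have "row N' i \<in> Rad A0" if i: "i < k" for i
  proof -
    have "transpose_mat A0 *\<^sub>v row N' i = 0\<^sub>v k"
    proof (rule eq_vecI)
      fix j assume "j < dim_vec (0\<^sub>v k :: 'f vec)"
      then have j: "j < k"
        by simp
      have "(transpose_mat A0 *\<^sub>v row N' i) $ j = (N' * A0) $$ (i, j)"
        using i j A0 N' by (simp add: comm_scalar_prod[of _ k])
      then show "(transpose_mat A0 *\<^sub>v row N' i) $ j = 0\<^sub>v k $ j"
        using N'A0 i j by simp
    qed (use A0 in simp)
    then show ?thesis
      unfolding Rad_def using A0 N' i by (intro mat_kernelI[of _ k k]) auto
  qed
  then have "\<exists>y\<in>carrier_vec t. row N' i = transpose_mat N *\<^sub>v y" if "i < k" for i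
    using N_span that by blast
  then obtain y where y: "\<And>i. i < k \<Longrightarrow> y i \<in> carrier_vec t"
    "\<And>i. i < k \<Longrightarrow> row N' i = transpose_mat N *\<^sub>v y i"
    by metis
  define Y where "Y = mat k t (\<lambda>(i, j). y i $ j)"
  have Y: "Y \<in> carrier_mat k t"
    by (simp add: Y_def)
  have "N' = Y * N"
  proof (rule eq_matI)
    fix i j assume "i < dim_row (Y * N)" "j < dim_col (Y * N)"
    then have ij: "i < k" "j < k"
      using Y N_carr by auto
    have "row Y i = y i"
      using ij y(1)[OF ij(1)] by (intro eq_vecI) (auto simp: Y_def)
    moreover have "N' $$ (i, j) = row N' i $ j"
      using ij N' by simp
    ultimately show "N' $$ (i, j) = (Y * N) $$ (i, j)"
      using ij Y N_carr y[OF ij(1)] by (simp add: comm_scalar_prod[of _ t])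
  qed (use N' Y N_carr in auto)
  then have "F = Y * (N * A1 * transpose_mat N) * transpose_mat Y"
    using sandwich[OF Y N_carr] F_eq by simp
  then have "vec_space.rank k F \<le> vec_space.rank t (N * A1 * transpose_mat N)"
    using rank_mult_le[of "N * A1 * transpose_mat N" t t Y k "transpose_mat Y" k] N_carr A1 Y by simp
  with le have "vec_space.rank t (N * A1 * transpose_mat N) = card {i. i < k \<and> c i = uu}"
    unfolding rank_F by (rule antisym)
  then show ?thesis
    unfolding A1_def t_def .
qed

section \<open>The length of a shortest embedding\<close>

text \<open>\<open>S\<close> lies between the rows of \<open>H\<close> and their span, so both
  conditions can be tested on rows: the first by bilinearity, the second because a self-product is
  the square of the coordinate sum, which is linear.\<close>

lemma self_orthogonal_monomial_iff:
  fixes H :: "'f::field mat"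
  assumes two: "(1::'f) + 1 = 0" and H: "H \<in> carrier_mat k n"
    and HH: "H * transpose_mat H = monomial_mat k \<pi> d"
    and pi: "\<And>i. i < k \<Longrightarrow> \<pi> i < k"
    and rows: "\<And>i. i < k \<Longrightarrow> row H i \<in> S"
    and S: "S \<subseteq> (\<lambda>w. transpose_mat H *\<^sub>v w) ` carrier_vec k"
  shows "self_orthogonal S \<longleftrightarrow> (\<forall>i<k. d i = 0)"
    and "(\<forall>x\<in>S. x \<bullet> x = 0) \<longleftrightarrow> (\<forall>i<k. d i \<noteq> 0 \<longrightarrow> \<pi> i \<noteq> i)"
proof -
  have row: "row H i \<bullet> row H j = (if j = \<pi> i then d i else 0)" if "i < k" "j < k" for i j
    using arg_cong[OF HH, of "\<lambda>M. M $$ (i, j)"] H that by (simp add: monomial_mat_def)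
  have comb: "(transpose_mat H *\<^sub>v w) \<bullet> (transpose_mat H *\<^sub>v w') = w \<bullet> (H * transpose_mat H *\<^sub>v w')"
    if "w \<in> carrier_vec k" "w' \<in> carrier_vec k" for w w'
  proof -
    have "(transpose_mat H *\<^sub>v w) \<bullet> (transpose_mat H *\<^sub>v w') =
        (transpose_mat H *\<^sub>v w') \<bullet> (transpose_mat H *\<^sub>v w)"
      using H that by (intro comm_scalar_prod[of _ n] mult_mat_vec_carrier[of _ n k]) auto
    also have "\<dots> = (H *\<^sub>v (transpose_mat H *\<^sub>v w')) \<bullet> w"
      using transpose_vec_mult_scalar[of "transpose_mat H" n k w "transpose_mat H *\<^sub>v w'"] H that
      by simp
    also have "\<dots> = w \<bullet> (H *\<^sub>v (transpose_mat H *\<^sub>v w'))"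
      using H that
      by (intro comm_scalar_prod[of _ k] mult_mat_vec_carrier[of _ k n] mult_mat_vec_carrier[of _ n k])
        auto
    finally show ?thesis
      using H that by (simp add: assoc_mult_mat_vec[of H k n _ k])
  qed
  show "self_orthogonal S \<longleftrightarrow> (\<forall>i<k. d i = 0)"
  proof
    assume "self_orthogonal S"
    then show "\<forall>i<k. d i = 0"
      using rows row pi unfolding self_orthogonal_def by metis
  next
    assume "\<forall>i<k. d i = 0"
    then have "H * transpose_mat H = 0\<^sub>m k k"
      unfolding HH by (intro eq_matI) (auto simp: monomial_mat_def)
    then have "(transpose_mat H *\<^sub>v w) \<bullet> (transpose_mat H *\<^sub>v w') = 0"
      if "w \<in> carrier_vec k" "w' \<in> carrier_vec k" for w w'
    proof -
      have "0\<^sub>m k k *\<^sub>v w' = 0\<^sub>v k"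
        using that by (intro eq_vecI) auto
      then show ?thesis
        using comb[OF that] \<open>H * transpose_mat H = 0\<^sub>m k k\<close> that by simp
    qed
    then show "self_orthogonal S"
      using S unfolding self_orthogonal_def by blast
  qed
  have square: "x \<bullet> x = (\<Sum>t<n. x $ t) * (\<Sum>t<n. x $ t)" if "x \<in> carrier_vec n" for x :: "'f vec"
    using that by (simp add: scalar_prod_def lessThan_atLeast0 char_two_square_sum[OF two])
  show "(\<forall>x\<in>S. x \<bullet> x = 0) \<longleftrightarrow> (\<forall>i<k. d i \<noteq> 0 \<longrightarrow> \<pi> i \<noteq> i)"
  proof
    assume "\<forall>x\<in>S. x \<bullet> x = 0"
    then show "\<forall>i<k. d i \<noteq> 0 \<longrightarrow> \<pi> i \<noteq> i"
      using rows row by metis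
  next
    assume alt: "\<forall>i<k. d i \<noteq> 0 \<longrightarrow> \<pi> i \<noteq> i"
    show "\<forall>x\<in>S. x \<bullet> x = 0"
    proof
      fix x assume "x \<in> S"
      then obtain w where w: "w \<in> carrier_vec k" "x = transpose_mat H *\<^sub>v w"
        using S by blast
      have "(\<Sum>t<n. H $$ (i, t)) = 0" if "i < k" for i
      proof -
        have "row H i \<bullet> row H i = 0"
          unfolding row[OF that that] using alt that by (cases "d i = 0") auto
        then show ?thesis
          using that H square[of "row H i"] by simp
      qed
      then have "(\<Sum>i<k. (\<Sum>t<n. H $$ (i, t)) * w $ i) = 0"
        by simp
      moreover have "(\<Sum>t<n. x $ t) = (\<Sum>t<n. \<Sum>i<k. H $$ (i, t) * w $ i)"
        using H w by (intro sum.cong) (auto simp: scalar_prod_def lessThan_atLeast0)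
      ultimately have "(\<Sum>t<n. x $ t) = 0"
        by (simp add: sum.swap[of _ "{..<n}"] sum_distrib_right)
      then show "x \<bullet> x = 0"
        using square[of x] w H by simp
    qed
  qed
qed

theorem theorem3p6:
  fixes C :: "'f::{field,finite} dual vec set"
    and G :: "'f dual mat"
    and A0 A1 N :: "'f mat"
    and q n k1 k2 r \<rho> :: nat
  assumes "CARD('f) = q" and "\<exists>m. q = 2 ^ m"
    and "linear_code n C"
    and "generator_matrix n C k1 k2 G"
    and "A0 \<in> carrier_mat (k1 + k2) (k1 + k2)"
    and "A1 \<in> carrier_mat (k1 + k2) (k1 + k2)"
    and "G * transpose_mat G = map_mat of_base A0 + uu \<cdot>\<^sub>m map_mat of_base A1"
    and "r = vec_space.rank (k1 + k2) A0"
    and "rows_form_basis (k1 + k2) N (Rad A0)"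
    and "\<rho> = vec_space.rank (dim_row N) (N * A1 * transpose_mat N)"
  shows "n_s n C =
    (if \<not> self_orthogonal (Res C) \<and> (\<forall>x\<in>Res C. x \<bullet> x = 0) \<and> \<rho> = 0
     then n + r + 1
     else n + r + \<rho>)"
proof -
  define k where "k = k1 + k2"
  have two: "(1::'f) + 1 = 0"
    using assms(1,2) char_two_of_card by blast
  have G: "G \<in> carrier_mat k n" and G_rows: "\<And>i. i < k \<Longrightarrow> row G i \<in> C"
    using assms(4) by (auto simp: generator_matrix_def k_def)
  define A where "A = G * transpose_mat G"
  have A: "A \<in> carrier_mat k k"
    using G by (simp add: A_def)
  have A0: "map_mat res A = A0" and A1: "map_mat upart A = A1"
    using assms(5,6) unfolding A_def assms(7) by (auto intro!: eq_matI)
  have gram: "gram_like k A"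
    unfolding A_def by (rule gram_like_mult_transpose[OF two G])
  obtain P Q \<pi> c where P: "P \<in> carrier_mat k k" and Q: "Q \<in> carrier_mat k k"
    and PQ: "P * Q = 1\<^sub>m k" "Q * P = 1\<^sub>m k"
    and pair: "pairing {..<k} \<pi> c" and nf: "P * A * transpose_mat P = monomial_mat k \<pi> c"
    by (rule gram_like_normal_form[OF two gram])
  have pi: "\<pi> i < k" "\<pi> (\<pi> i) = i" "c (\<pi> i) = c i" "c i = 1 \<or> c i = uu \<or> c i = 0" if "i < k" for i
    using pair that by (auto simp: pairing_def)
  have res_c: "res (c i) = 1 \<longleftrightarrow> c i = 1" "res (c i) = 0 \<longleftrightarrow> c i \<noteq> 1" if "i < k" for i
    using pi(4)[OF that] by auto
  \<comment> \<open>The rows of \<open>P * G\<close> reduced modulo u: generators of the residue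
    code whose Gram matrix is already in normal form.\<close>
  define H where "H = map_mat res (P * G)"
  have H: "H \<in> carrier_mat k n"
    using P G by (simp add: H_def)
  have PG: "P * G \<in> carrier_mat k n"
    using P G by simp
  have map_t: "map_mat f (transpose_mat X) = transpose_mat (map_mat f X)"
    for f :: "'f dual \<Rightarrow> 'f" and X
    by (intro eq_matI) auto
  have HH: "H * transpose_mat H = monomial_mat k \<pi> (\<lambda>i. res (c i))"
  proof -
    have "map_mat res (monomial_mat k \<pi> c) = map_mat res (P * G * transpose_mat (P * G))"
      unfolding mult_congruence[OF P G] nf[symmetric] A_def ..
    also have "\<dots> = H * transpose_mat H"
      unfolding H_def using map_mat_res_mult[OF PG, of "transpose_mat (P * G)" k] PG
      by (simp add: map_t)
    finally have "H * transpose_mat H = map_mat res (monomial_mat k \<pi> c)" ..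
    also have "\<dots> = monomial_mat k \<pi> (\<lambda>i. res (c i))"
      by (auto simp: monomial_mat_def intro!: eq_matI)
    finally show ?thesis .
  qed
  have r: "r = card {i \<in> {..<k}. c i = 1}"
  proof -
    have "r = vec_space.rank k A0"
      using assms(8) by (simp add: k_def)
    also have "\<dots> = vec_space.rank k (map_mat res P * A0 * transpose_mat (map_mat res P))"
    proof (rule rank_congruent[symmetric])
      show "map_mat res Q * map_mat res P = 1\<^sub>m k"
        using map_mat_res_mult[OF Q P] PQ by (simp add: map_mat_res_one)
    qed (use P Q assms(5) in \<open>auto simp: k_def\<close>)
    also have "map_mat res P * A0 * transpose_mat (map_mat res P) =
        map_mat res (monomial_mat k \<pi> c)"
      unfolding nf[symmetric] A0[symmetric] using P A
      by (simp add: map_mat_res_mult[of _ k k _ k] map_t)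
    also have "\<dots> = monomial_mat k \<pi> (\<lambda>i. res (c i))"
      by (auto simp: monomial_mat_def intro!: eq_matI)
    also have "vec_space.rank k \<dots> = card {i. i < k \<and> res (c i) = 1}"
      by (rule rank_monomial_mat) (use pi res_c in auto)
    also have "{i. i < k \<and> res (c i) = 1} = {i \<in> {..<k}. c i = 1}"
      using res_c by auto
    finally show ?thesis .
  qed
  have \<rho>: "\<rho> = card {i \<in> {..<k}. c i = uu}"
  proof -
    have "transpose_mat A = A"
      using gram by (intro eq_matI) (auto simp: gram_like_def)
    then have "\<rho> = card {i. i < k \<and> c i = uu}"
      using rank_radical_form[OF A _ P Q PQ pair nf] assms(9,10) unfolding A0 A1 k_def by blast
    then show ?thesis
      by simp
  qed
  have rows: "row H i \<in> Res C" if i: "i < k" for i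
  proof -
    have "row (P * G) i = transpose_mat G *\<^sub>v row P i"
    proof (rule eq_vecI)
      fix j assume "j < dim_vec (transpose_mat G *\<^sub>v row P i)"
      then show "row (P * G) i $ j = (transpose_mat G *\<^sub>v row P i) $ j"
        using i P G by (simp add: comm_scalar_prod[of _ k])
    qed (use i P G in simp)
    moreover have "transpose_mat G *\<^sub>v row P i \<in> C"
      by (rule smult_rows_in_code[OF assms(3) G G_rows]) (use P i in auto)
    moreover have "row H i = map_vec res (row (P * G) i)"
      using i PG by (auto simp: H_def intro!: eq_vecI)
    ultimately show ?thesis
      by (auto simp: Res_def)
  qed
  have Res: "Res C \<subseteq> (\<lambda>w. transpose_mat H *\<^sub>v w) ` carrier_vec k"
  proof
    fix x assume "x \<in> Res C"
    then obtain v where v: "v \<in> C" "x = map_vec res v"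
      by (auto simp: Res_def)
    then obtain w where w: "w \<in> carrier_vec k" "v = transpose_mat G *\<^sub>v w"
      using assms(4) unfolding generator_matrix_def k_def by blast
    \<comment> \<open>Coordinates of the codeword with respect to the rows of \<open>P * G\<close>:
      the transpose of \<open>P\<close> undoes the transpose of \<open>Q\<close>.\<close>
    define w' where "w' = transpose_mat Q *\<^sub>v w"
    have w': "w' \<in> carrier_vec k"
      using Q w by (simp add: w'_def)
    have "transpose_mat P * transpose_mat Q = 1\<^sub>m k"
      using PQ P Q by (metis transpose_mult transpose_one)
    then have "transpose_mat P *\<^sub>v w' = w"
      using w P Q by (simp add: w'_def flip: assoc_mult_mat_vec[of _ k k _ k])
    then have "v = transpose_mat (P * G) *\<^sub>v w'"
      using w w' P G by (simp add: transpose_mult[OF P G] assoc_mult_mat_vec[of _ n k _ k])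
    then have "x = transpose_mat H *\<^sub>v map_vec res w'"
      using v PG w' by (auto simp: H_def scalar_prod_def intro!: eq_vecI)
    then show "x \<in> (\<lambda>w. transpose_mat H *\<^sub>v w) ` carrier_vec k"
      using w' by auto
  qed
  have "self_orthogonal (Res C) \<longleftrightarrow> (\<forall>i<k. res (c i) = 0)"
    by (rule self_orthogonal_monomial_iff(1)[OF two H HH pi(1) rows Res])
  \<comment> \<open>\<open>r\<close> counts the unit indices, so condition (i) says that there is
    one; condition (ii) will say that no unit index is fixed by \<pi>.\<close>
  then have "\<not> self_orthogonal (Res C) \<longleftrightarrow> r > 0"
    unfolding r using res_c by (auto simp: card_gt_0_iff)
  moreover have "(\<forall>x\<in>Res C. x \<bullet> x = 0) \<longleftrightarrow> (\<forall>i<k. res (c i) \<noteq> 0 \<longrightarrow> \<pi> i \<noteq> i)"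
    by (rule self_orthogonal_monomial_iff(2)[OF two H HH pi(1) rows Res])
  then have "(\<forall>x\<in>Res C. x \<bullet> x = 0) \<longleftrightarrow> (\<forall>i\<in>{..<k}. c i = 1 \<longrightarrow> \<pi> i \<noteq> i)"
    using res_c by auto
  ultimately have goal: "(if \<not> self_orthogonal (Res C) \<and> (\<forall>x\<in>Res C. x \<bullet> x = 0) \<and> \<rho> = 0
     then n + r + 1 else n + r + \<rho>) =
    n + (if r > 0 \<and> (\<forall>i\<in>{..<k}. c i = 1 \<longrightarrow> \<pi> i \<noteq> i) \<and> \<rho> = 0 then r + 1 else r + \<rho>)"
    by simp
  \<comment> \<open>Existence of an embedding is carried to the Gram matrix of \<open>G\<close>,
    then by congruence to the normal form, where the column bounds apply.\<close>
  have iff: "(\<exists>D. self_orthogonal_embedding n C l D) \<longleftrightarrow>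
      (\<exists>m. l = n + m \<and> (\<exists>b. realizes m {..<k} \<pi> c b))" for l
    unfolding self_orthogonal_embedding_iff[OF two assms(4)] A_def[symmetric] k_def[symmetric]
      ex_mult_transpose_congruent[OF A P Q PQ(2)] nf ex_mult_transpose_monomial_iff ..
  show ?thesis
    unfolding goal n_s_def iff
  proof (rule Least_equality)
    show "\<exists>m. n + (if r > 0 \<and> (\<forall>i\<in>{..<k}. c i = 1 \<longrightarrow> \<pi> i \<noteq> i) \<and> \<rho> = 0 then r + 1 else r + \<rho>) =
        n + m \<and> (\<exists>b. realizes m {..<k} \<pi> c b)"
      using realizes_exists[OF two _ pair r \<rho>] by blast
    show "n + (if r > 0 \<and> (\<forall>i\<in>{..<k}. c i = 1 \<longrightarrow> \<pi> i \<noteq> i) \<and> \<rho> = 0 then r + 1 else r + \<rho>) \<le> l"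
      if "\<exists>m. l = n + m \<and> (\<exists>b. realizes m {..<k} \<pi> c b)" for l
    proof -
      from that obtain m b where "l = n + m" "realizes m {..<k} \<pi> c b"
        by blast
      with realizes_lower_bound[OF two _ pair this(2) r \<rho>] show ?thesis
        by simp
    qed
  qed
qed

end
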